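(* Let $b\ge 0$ and consider the state-dependent delay differential equation $$u'(t)=\alpha u(t)+\beta u(t-1-u(t-b))$$ near the equilibrium $u\equiv 0$ and near the parameter point $(\alpha,\beta)=(1,-1)$, at which the linearization about $u\equiv 0$ has the eigenvalue $0$ with algebraic multiplicity $2$. Introduce parameters $(p,q)\in\mathbb{R}^2$ by $$\begin{bmatrix}\alpha\\ \beta\end{bmatrix}=\begin{bmatrix}1\\-1\end{bmatrix}+\begin{bmatrix}1/3&1/2\\ 1/6&-1/2\end{bmatrix}\begin{bmatrix}p\\ q\end{bmatrix}.$$ Let $x_c\in\mathbb{R}^2$ be the coordinates on the two-dimensional, parameter-dependent local center manifold with (formal) expansion $h$ and associated ODE for $x_c$ as specified in the context, and let $y_c=(y_{c,1},y_{c,2})\in\mathbb{R}^2$ be defined by $$x_c=\begin{bmatrix}1&1/3\\0&1\end{bmatrix}y_c .$$ Then, to second order, the resulting ODE on the center manifold, written as a second-order differential equation for $y=y_{c,1}$ (with $\dot y_{c,1}=y_{c,2}$), is $$\ddot y=p\,y+q\,\dot y+2y\dot y+\left(\tfrac23-2b\right)\dot y^2+O(3),$$ where $O(3)$ denotes terms of order at least three in $(y,\dot y,p,q)$.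
   Context: Let $\tau_{\max}<\infty$ be larger than $1$ and $b$, let $C=C([-\tau_{\max},0],\mathbb{R})$, and let $u_t(\theta)=u(t+\theta)$ denote history segments. The DDE is $u'(t)=f_{p,q}(u_t)$ with $f_{p,q}(\phi)=\alpha\phi(0)+\beta\phi(-1-\phi(-b))$, where $(\alpha,\beta)$ is the function of $(p,q)$ given in the claim. At $(p,q)=(0,0)$ the linearization about $u\equiv 0$ is $x'(t)=x(t)-x(t-1)$. Its eigenvalue $0$ is double, and the corresponding generalized eigenspace has the basis $B(\theta)=[1,\theta]$ (a row vector of functions, so that $Bx_c$ is the function $\theta\mapsto x_{c,1}+x_{c,2}\theta$ for $x_c\in\mathbb{R}^2$). The spectral projection onto $\operatorname{span}B$ is $BB^\dagger$, where $B^\dagger:C\to\mathbb{R}^2$ is $$B^\dagger u=\begin{bmatrix}2/3\\2\end{bmatrix}u(0)+\int_{-1}^0\begin{bmatrix}2s+4/3\\-2\end{bmatrix}u(s)\,\mathrm{d}s .$$ Put $J_0=\begin{bmatrix}0&1\\0&0\end{bmatrix}$. The center manifold is taken as a graph over $\operatorname{span}B$ depending on the parameters, with expansion, up to any order $m$, $$h(x_c;p;q)(\theta)=B(\theta)x_c+\sum_{j=2}^m h^j(\theta)(x_c;p;q)^j+\cdots,$$ and the ODE on the center manifold has the expansion $$\dot x_c=J_0x_c+\sum_{j=2}^mA_c^j(x_c;p;q)^j+\cdots,\qquad \dot p=0,\quad \dot q=0.$$ Here $h^j(\theta)$ and $A_c^j$ are symmetric $j$-linear forms on $\mathbb{R}^4$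 (with values in $\mathbb{R}$ and $\mathbb{R}^2$, respectively) evaluated on $j$ copies of the vector $(x_c;p;q)\in\mathbb{R}^4$. The expansions are understood as formal expansions in $(x_c,p,q)$. For each order $j\ge2$ the coefficients $h^j$ and $A_c^j$ are determined (uniquely) by comparing coefficients of order $j$ in the invariance equations $$\partial_{x_c}h(x_c;p;q)(\theta)\,\dot x_c=\partial_\theta h(x_c;p;q)(\theta),\qquad \partial_\theta h(x_c;p;q)(0)=f_{p,q}\bigl(h(x_c;p;q)(\cdot)\bigr),$$ where $\dot x_c$ is replaced by the expansion above, together with the orthogonality condition $$B^\dagger\bigl[\theta\mapsto h^j(\theta)(x_c;p;q)^j\bigr]=0 .$$ "To second order" means that the expansion of the ODE is given up to and including all terms of order two in $(x_c,p,q)$ (equivalently in $(y,\dot y,p,q)$), counting the parameters $p,q$ as variables. *)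

theory Defs
  imports "HOL-Complex_Analysis.Complex_Analysis" "HOL-Library.Landau_Symbols"
begin

type_synonym state = "(real ^ 2) \<times> real \<times> real"

text \<open>A \<open>j\<close>-linear form takes its arguments as a sequence of which only the first \<open>j\<close>
  entries matter. Evaluation on \<open>j\<close> copies of \<open>z\<close> is application to \<open>\<lambda>_. z\<close>.\<close>

definition symmetric_multilinear ::
    "nat \<Rightarrow> ((nat \<Rightarrow> 'a::real_vector) \<Rightarrow> 'b::real_vector) \<Rightarrow> bool" where
  "symmetric_multilinear j M \<longleftrightarrow>
     (\<forall>v w. (\<forall>i<j. v i = w i) \<longrightarrow> M v = M w) \<and>
     (\<forall>v. \<forall>i<j. linear (\<lambda>x. M (v(i := x)))) \<and>
     (\<forall>v \<pi>. \<pi> permutes {..<j} \<longrightarrow> M (v \<circ> \<pi>) = M v)"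

definition alpha_beta :: "real \<Rightarrow> real \<Rightarrow> real ^ 2" where
  "alpha_beta p q =
     vector [1, -1] + (vector [vector [1/3, 1/2], vector [1/6, -1/2]] :: real ^ 2 ^ 2) *v vector [p, q]"

definition dde_rhs :: "real \<Rightarrow> real \<Rightarrow> real \<Rightarrow> (real \<Rightarrow> real) \<Rightarrow> real" where
  "dde_rhs b p q \<phi> =
     alpha_beta p q $ 1 * \<phi> 0 + alpha_beta p q $ 2 * \<phi> (- 1 - \<phi> (- b))"

text \<open>Directional derivative at the zero function; a Frechet derivative on the space of
  continuous functions does not exist because of the state-dependent delay.\<close>

definition linearization :: "((real \<Rightarrow> real) \<Rightarrow> real) \<Rightarrow> (real \<Rightarrow> real) \<Rightarrow> real" where
  "linearization F \<phi> = deriv (\<lambda>\<epsilon>. F (\<lambda>\<theta>. \<epsilon> * \<phi> \<theta>)) 0"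

text \<open>Characteristic function of \<open>x'(t) = L x\<^sub>t\<close> for a real functional \<open>L\<close>, obtained by
  inserting \<open>exp (\<lambda> t)\<close> (with \<open>L\<close> extended complex-linearly). The algebraic multiplicity of an
  eigenvalue is its order as a zero of this function.\<close>

definition char_fun :: "((real \<Rightarrow> real) \<Rightarrow> real) \<Rightarrow> complex \<Rightarrow> complex" where
  "char_fun L z = z - Complex (L (\<lambda>\<theta>. Re (exp (z * of_real \<theta>)))) (L (\<lambda>\<theta>. Im (exp (z * of_real \<theta>))))"

definition basis_row :: "real \<Rightarrow> real ^ 2" where
  "basis_row \<theta> = vector [1, \<theta>]"

definition B_dagger :: "(real \<Rightarrow> real) \<Rightarrow> real ^ 2" where
  "B_dagger u =
     u 0 *\<^sub>R vector [2/3, 2] + integral {-1..0} (\<lambda>s. u s *\<^sub>R (vector [2 * s + 4/3, -2] :: real ^ 2))"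

definition J0 :: "real ^ 2 ^ 2" where
  "J0 = vector [vector [0, 1], vector [0, 0]]"

definition cm_graph ::
    "nat \<Rightarrow> (nat \<Rightarrow> real \<Rightarrow> (nat \<Rightarrow> state) \<Rightarrow> real) \<Rightarrow> state \<Rightarrow> real \<Rightarrow> real" where
  "cm_graph m h z \<theta> = basis_row \<theta> \<bullet> fst z + (\<Sum>j=2..m. h j \<theta> (\<lambda>_. z))"

definition cm_field :: "nat \<Rightarrow> (nat \<Rightarrow> (nat \<Rightarrow> state) \<Rightarrow> real ^ 2) \<Rightarrow> state \<Rightarrow> real ^ 2" where
  "cm_field m A z = J0 *v fst z + (\<Sum>j=2..m. A j (\<lambda>_. z))"

definition vanishes_to_order :: "nat \<Rightarrow> (state \<Rightarrow> real) \<Rightarrow> bool" where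
  "vanishes_to_order n F \<longleftrightarrow> F \<in> O[nhds 0](\<lambda>z. norm z ^ n)"

text \<open>Coefficients \<open>h j\<close>, \<open>A j\<close> of a formal centre manifold expansion, for orders \<open>j\<close> from 2 to
  \<open>m\<close>. Agreement of all coefficients up to order \<open>m\<close> in the two invariance equations is
  expressed by the residual of the truncated expansions having order at least \<open>m + 1\<close> at the
  origin. Derivatives with respect to \<open>\<theta>\<close> are one-sided at the end points. The history
  argument \<open>- 1 - h (- b)\<close> lies in the interval \<open>{-\<tau>..0}\<close> for small states because \<open>\<tau> > 1\<close>.\<close>

definition cm_expansion ::
    "real \<Rightarrow> real \<Rightarrow> nat \<Rightarrow> (nat \<Rightarrow> real \<Rightarrow> (nat \<Rightarrow> state) \<Rightarrow> real) \<Rightarrow>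
     (nat \<Rightarrow> (nat \<Rightarrow> state) \<Rightarrow> real ^ 2) \<Rightarrow> bool" where
  "cm_expansion \<tau> b m h A \<longleftrightarrow>
     (\<forall>j\<in>{2..m}.
        (\<forall>\<theta>\<in>{-\<tau>..0}. symmetric_multilinear j (h j \<theta>)) \<and>
        symmetric_multilinear j (A j) \<and>
        (\<forall>z. (\<lambda>\<theta>. h j \<theta> (\<lambda>_. z)) differentiable_on {-\<tau>..0}) \<and>
        (\<forall>z. B_dagger (\<lambda>\<theta>. h j \<theta> (\<lambda>_. z)) = 0)) \<and>
     (\<forall>\<theta>\<in>{-\<tau>..0}. vanishes_to_order (m + 1) (\<lambda>(x, p, q).
        frechet_derivative (\<lambda>x'. cm_graph m h (x', p, q) \<theta>) (at x) (cm_field m A (x, p, q)) -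
        vector_derivative (cm_graph m h (x, p, q)) (at \<theta> within {-\<tau>..0}))) \<and>
     vanishes_to_order (m + 1) (\<lambda>(x, p, q).
        vector_derivative (cm_graph m h (x, p, q)) (at 0 within {-\<tau>..0}) -
        dde_rhs b p q (cm_graph m h (x, p, q)))"

definition T_mat :: "real ^ 2 ^ 2" where
  "T_mat = vector [vector [1, 1/3], vector [0, 1]]"

text \<open>The vector field of the differential equation for \<open>y\<close>, where \<open>x = T_mat *v y\<close>.\<close>

definition cm_field_y :: "nat \<Rightarrow> (nat \<Rightarrow> (nat \<Rightarrow> state) \<Rightarrow> real ^ 2) \<Rightarrow> state \<Rightarrow> real ^ 2" where
  "cm_field_y m A = (\<lambda>(y, p, q). matrix_inv T_mat *v cm_field m A (T_mat *v y, p, q))"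

end

theory Submission
  imports Defs
begin

text \<open>
  The first invariance equation says that, at each order \<open>j \<ge> 2\<close>,
  \<open>\<partial>\<^sub>\<theta> h\<^sup>j(\<theta>)\<close> is \<open>B(\<theta>) A\<^sup>j\<close> plus directional derivatives in \<open>x\<^sub>c\<close> of graph
  coefficients \<open>h\<^sup>k\<close> with \<open>k \<ge> 2\<close>. The orthogonality condition says that \<open>B\<^sup>\<dagger>\<close> kills
  these \<open>h\<^sup>k\<close> at every state, hence also these derivatives, and \<open>B\<^sup>\<dagger> B\<close> is the identity. Applying
  \<open>B\<^sup>\<dagger>\<close> therefore isolates \<open>A\<^sup>j = B\<^sup>\<dagger> (\<partial>\<^sub>\<theta> h\<^sup>j)\<close>. Integration by parts in \<open>B\<^sup>\<dagger>\<close>, once more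
  with \<open>B\<^sup>\<dagger> h\<^sup>j = 0\<close>, turns this into
  \<open>A\<^sup>j = (\<partial>\<^sub>\<theta> h\<^sup>j(0) - h\<^sup>j(0) + h\<^sup>j(-1)) (2/3, 2)\<close>. This is lemma \<open>field_coeff_direction\<close>, and it
  holds at every order. Its scalar factor is the amount by which \<open>h\<^sup>j\<close> fails the linearized
  delay equation \<open>x'(t) = x(t) - x(t-1)\<close>.

  Since all nonlinear terms of the vector field are multiples of \<open>(2/3, 2)\<close>, the coordinates
  \<open>y\<^sub>1 = x\<^sub>1 - x\<^sub>2/3\<close>, \<open>y\<^sub>2 = x\<^sub>2\<close> satisfy \<open>y\<^sub>1' = y\<^sub>2\<close> exactly, which is why the reduced system is a
  second-order scalar equation.

  For \<open>j = 2\<close> the scalar factor is read off from the second invariance equation: it is the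
  quadratic part of the nonlinearity evaluated on the linear graph \<open>x\<^sub>1 + \<theta> x\<^sub>2\<close> (lemma
  \<open>quadratic_defect\<close>). The delay \<open>-1 - h(-b)\<close> contributes \<open>x\<^sub>2 (x\<^sub>1 - b x\<^sub>2)\<close>, the parameters
  contribute the rest. The orders from 3 on form the remainder.

  Coefficients are compared along the rays \<open>t \<mapsto> t z\<close>: every coefficient is homogeneous, so
  the residual of the first equation is a polynomial in \<open>t\<close>, and one that is \<open>O(t\<^sup>m\<^sup>+\<^sup>1)\<close> has no
  coefficients up to order \<open>m\<close>. The second residual need not be a polynomial in \<open>t\<close>, because the
  state-dependent delay enters the graph through its argument; there, dividing by \<open>t\<^sup>2\<close> and passing
  to the limit, with the graph coefficients continuous in \<open>\<theta>\<close>, gives the second order.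

  The characteristic function at the bifurcation point is \<open>z - 1 + exp (- z)\<close>. It vanishes at 0
  together with its derivative, while its second derivative there is 1.
\<close>

(* The symbol $ selects vector components throughout; power series use the same symbol. *)
no_notation fps_nth (infixl "$" 75)

section \<open>Multilinear forms on the diagonal\<close>

text \<open>As in \<^const>\<open>symmetric_multilinear\<close>, the arguments form a sequence of which only the first
  \<open>j\<close> entries matter. This makes a form in \<open>j + 1\<close> arguments with the last one fixed a form in
  \<open>j\<close> arguments of the same type, which is the step of the inductions below.\<close>


definition multilinear_form :: "nat \<Rightarrow> ((nat \<Rightarrow> 'a::real_vector) \<Rightarrow> real) \<Rightarrow> bool" where
  "multilinear_form j M \<longleftrightarrow>
     (\<forall>v w. (\<forall>i<j. v i = w i) \<longrightarrow> M v = M w) \<and>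
     (\<forall>v. \<forall>i<j. linear (\<lambda>x. M (v(i := x))))"

lemma multilinear_form_0:
  assumes "multilinear_form 0 M" shows "M v = M w"
  using assms by (auto simp: multilinear_form_def)

lemma multilinear_form_fix_last:
  assumes "multilinear_form (Suc j) M"
  shows "multilinear_form j (\<lambda>v. M (v(j := e)))"
  unfolding multilinear_form_def
proof (intro conjI allI impI)
  fix v w :: "nat \<Rightarrow> 'a" assume "\<forall>i<j. v i = w i"
  then have "\<forall>i<Suc j. (v(j := e)) i = (w(j := e)) i"
    by (auto simp: less_Suc_eq)
  then show "M (v(j := e)) = M (w(j := e))"
    using assms unfolding multilinear_form_def by blast
next
  fix v :: "nat \<Rightarrow> 'a" and i assume i: "i < j"
  then have "(\<lambda>x. M ((v(i := x))(j := e))) = (\<lambda>x. M ((v(j := e))(i := x)))"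
    by (simp add: fun_upd_twist)
  then show "linear (\<lambda>x. M ((v(i := x))(j := e)))"
    using assms i unfolding multilinear_form_def by simp
qed

lemma multilinear_form_linear_last:
  assumes "multilinear_form (Suc j) M"
  shows "linear (\<lambda>x. M (v(j := x)))"
  using assms by (simp add: multilinear_form_def)

lemma multilinear_form_homogeneous:
  assumes "multilinear_form j M"
  shows "M (\<lambda>_. t *\<^sub>R z) = t ^ j * M (\<lambda>_. z)"
  using assms
proof (induction j arbitrary: M)
  case 0
  then show ?case using multilinear_form_0 by fastforce
next
  case (Suc j)
  have "M (\<lambda>_. t *\<^sub>R z) = M ((\<lambda>_. t *\<^sub>R z)(j := t *\<^sub>R z))"
    by (simp add: fun_upd_idem)
  also have "\<dots> = t * M ((\<lambda>_. t *\<^sub>R z)(j := z))"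
    by (simp only: linear_scale[OF multilinear_form_linear_last[OF Suc.prems]] real_scaleR_def)
  also have "\<dots> = t * (t ^ j * M ((\<lambda>_. z)(j := z)))"
    by (simp only: Suc.IH[OF multilinear_form_fix_last[OF Suc.prems]])
  finally show ?case by (simp add: fun_upd_idem)
qed

text \<open>Expanding the last argument in a basis reduces a form in \<open>j + 1\<close> arguments to forms in \<open>j\<close>.
  The purpose is differentiability and continuity on the whole space.\<close>

lemma multilinear_form_real_polynomial:
  fixes M :: "(nat \<Rightarrow> 'a::euclidean_space) \<Rightarrow> real"
  assumes "multilinear_form j M"
  shows "real_polynomial_function (\<lambda>z. M (\<lambda>_. z))"
  using assms
proof (induction j arbitrary: M)
  case 0
  then have "(\<lambda>z. M (\<lambda>_. z)) = (\<lambda>z. M (\<lambda>_. 0))"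
    using multilinear_form_0 by blast
  then show ?case by (metis real_polynomial_function.intros(2))
next
  case (Suc j)
  have "M (\<lambda>_. z) = (\<Sum>e\<in>Basis. (z \<bullet> e) * M ((\<lambda>_. z)(j := e)))" for z
  proof -
    have "M (\<lambda>_. z) = M ((\<lambda>_. z)(j := (\<Sum>e\<in>Basis. (z \<bullet> e) *\<^sub>R e)))"
      by (simp add: fun_upd_idem euclidean_representation)
    also have "\<dots> = (\<Sum>e\<in>Basis. M ((\<lambda>_. z)(j := (z \<bullet> e) *\<^sub>R e)))"
      by (rule linear_sum[OF multilinear_form_linear_last[OF Suc.prems]])
    also have "\<dots> = (\<Sum>e\<in>Basis. (z \<bullet> e) * M ((\<lambda>_. z)(j := e)))"
      by (simp only: linear_scale[OF multilinear_form_linear_last[OF Suc.prems]] real_scaleR_def)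
    finally show ?thesis .
  qed
  then have "(\<lambda>z. M (\<lambda>_. z)) = (\<lambda>z. \<Sum>e\<in>Basis. (z \<bullet> e) * M ((\<lambda>_. z)(j := e)))"
    by blast
  moreover have "real_polynomial_function (\<lambda>z. (z \<bullet> e) * M ((\<lambda>_. z)(j := e)))" for e
    by (rule real_polynomial_function.intros(4)[OF
        real_polynomial_function.intros(1)[OF bounded_linear_inner_left]
        Suc.IH[OF multilinear_form_fix_last[OF Suc.prems]]])
  then have "real_polynomial_function (\<lambda>z. \<Sum>e\<in>Basis. (z \<bullet> e) * M ((\<lambda>_. z)(j := e)))"
    by (intro real_polynomial_function_sum) auto
  ultimately show ?case by simp
qed

text \<open>The point is the degree bound: when the form depends on \<open>\<theta>\<close>, one bound serves all \<open>\<theta>\<close>,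
  so that directional derivatives can be recovered from values by a formula independent of
  \<open>\<theta>\<close>.\<close>

lemma multilinear_form_polynomial_on_line:
  assumes "multilinear_form j M"
  shows "\<exists>c. \<forall>s. M (\<lambda>_. z + s *\<^sub>R v) = (\<Sum>i\<le>j. c i * s ^ i)"
  using assms
proof (induction j arbitrary: M)
  case 0
  then have "\<forall>s. M (\<lambda>_. z + s *\<^sub>R v) = M (\<lambda>_. z)"
    using multilinear_form_0 by blast
  then show ?case by (intro exI[of _ "\<lambda>_. M (\<lambda>_. z)"]) simp
next
  case (Suc j)
  let ?w = "\<lambda>s (_::nat). z + s *\<^sub>R v"
  obtain c where c: "\<And>s. M ((?w s)(j := z)) = (\<Sum>i\<le>j. c i * s ^ i)"
    using Suc.IH[OF multilinear_form_fix_last[OF Suc.prems]] by blast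
  obtain d where d: "\<And>s. M ((?w s)(j := v)) = (\<Sum>i\<le>j. d i * s ^ i)"
    using Suc.IH[OF multilinear_form_fix_last[OF Suc.prems]] by blast
  define e where "e i = (if i \<le> j then c i else 0) + (if i = 0 then 0 else d (i - 1))" for i
  have "M (?w s) = (\<Sum>i\<le>Suc j. e i * s ^ i)" for s
  proof -
    have "M (?w s) = M ((?w s)(j := z + s *\<^sub>R v))"
      by (simp add: fun_upd_idem)
    also have "\<dots> = M ((?w s)(j := z)) + s * M ((?w s)(j := v))"
      by (simp only: linear_add[OF multilinear_form_linear_last[OF Suc.prems]]
          linear_scale[OF multilinear_form_linear_last[OF Suc.prems]] real_scaleR_def)
    also have "\<dots> = (\<Sum>i\<le>j. c i * s ^ i) + (\<Sum>i\<le>j. d i * s ^ Suc i)"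
      unfolding c d by (simp add: sum_distrib_left mult_ac)
    also have "(\<Sum>i\<le>j. c i * s ^ i) = (\<Sum>i\<le>Suc j. (if i \<le> j then c i else 0) * s ^ i)"
      by simp
    also have "(\<Sum>i\<le>j. d i * s ^ Suc i) = (\<Sum>i\<le>Suc j. (if i = 0 then 0 else d (i - 1)) * s ^ i)"
      by (simp add: sum.atMost_Suc_shift del: sum.atMost_Suc)
    finally show ?thesis
      by (simp only: e_def distrib_right sum.distrib)
  qed
  then show ?case by blast
qed

section \<open>Homogeneous functions and polynomial curves\<close>

text \<open>Interpolation: replacing \<open>P(s)\<close> by \<open>P(2 s) - 2\<^sup>n\<^sup>+\<^sup>1 P(s)\<close> removes the coefficient of degree
  \<open>n + 1\<close>, rescales the linear one by a nonzero factor, and stays in the subspace. Thus a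
  linear functional that vanishes on a polynomial curve vanishes on its velocity, with no
  limit to interchange with the functional.\<close>

lemma subspace_contains_linear_coefficient:
  fixes V :: "('a \<Rightarrow> real) \<Rightarrow> bool"
  assumes comb: "\<And>f g r s. V f \<Longrightarrow> V g \<Longrightarrow> V (\<lambda>x. r * f x + s * g x)"
    and curve: "\<And>s. V (\<lambda>x. \<Sum>i\<le>n. c x i * s ^ i)" and "1 \<le> n"
  shows "V (\<lambda>x. c x 1)"
  using \<open>1 \<le> n\<close> curve
proof (induction n arbitrary: c rule: dec_induct)
  case base
  have "V (\<lambda>x. 1 * (\<Sum>i\<le>1. c x i * 1 ^ i) + (-1) * (\<Sum>i\<le>1. c x i * 0 ^ i))"
    by (intro comb base)
  then show ?case by simp
next
  case (step n)
  let ?d = "\<lambda>i. 2 ^ i - 2 ^ Suc n :: real"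
  have "V (\<lambda>x. \<Sum>i\<le>n. (?d i * c x i) * s ^ i)" for s
  proof -
    have "V (\<lambda>x. 1 * (\<Sum>i\<le>Suc n. c x i * (2 * s) ^ i) + (- (2 ^ Suc n)) * (\<Sum>i\<le>Suc n. c x i * s ^ i))"
      by (intro comb step.prems)
    moreover have "1 * (\<Sum>i\<le>Suc n. c x i * (2 * s) ^ i) + (- (2 ^ Suc n)) * (\<Sum>i\<le>Suc n. c x i * s ^ i)
        = (\<Sum>i\<le>Suc n. (?d i * c x i) * s ^ i)" for x
      unfolding sum_distrib_left sum.distrib[symmetric]
      by (intro sum.cong refl) (simp add: algebra_simps power_mult_distrib)
    ultimately show ?thesis by simp
  qed
  then have "V (\<lambda>x. ?d 1 * c x 1)" by (rule step.IH)
  then have "V (\<lambda>x. (1 / ?d 1) * (?d 1 * c x 1) + 0 * (?d 1 * c x 1))"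
    by (intro comb)
  moreover have "(2::real) ^ 1 < 2 ^ Suc n"
    using step.hyps by (intro power_strict_increasing) auto
  ultimately show ?case by simp
qed

text \<open>The constant is a bound on the unit sphere, which homogeneity transports to every radius.\<close>

lemma homogeneous_bigo:
  fixes F :: "'a::euclidean_space \<Rightarrow> real"
  assumes cont: "continuous_on UNIV F"
    and hom: "\<And>t z. F (t *\<^sub>R z) = t ^ j * F z" and "n \<le> j"
  shows "F \<in> O[nhds 0](\<lambda>z. norm z ^ n)"
proof -
  have "bounded (F ` sphere 0 1)"
    by (intro compact_imp_bounded compact_continuous_image continuous_on_subset[OF cont]) auto
  then obtain C where C: "\<And>z. norm z = 1 \<Longrightarrow> \<bar>F z\<bar> \<le> C"
    unfolding bounded_iff by fastforce
  have "\<bar>F z\<bar> \<le> max 0 C * norm z ^ n" if z: "norm z < 1" for z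
  proof (cases "z = 0")
    case True
    show ?thesis
    proof (cases "j = 0")
      case True
      then have "F z = F y" for y using hom[of 0 y] hom[of 0 z] by simp
      moreover obtain e :: 'a where "norm e = 1" using vector_choose_size zero_le_one by blast
      ultimately have "\<bar>F z\<bar> \<le> C" using C by metis
      then show ?thesis using True \<open>n \<le> j\<close> by simp
    next
      case False
      then have "F 0 = 0" using hom[of 0 z] by simp
      then show ?thesis using \<open>z = 0\<close> by simp
    qed
  next
    case False
    have "F z = norm z ^ j * F (z /\<^sub>R norm z)"
      using hom[of "norm z" "z /\<^sub>R norm z"] False by simp
    then have "\<bar>F z\<bar> = norm z ^ j * \<bar>F (z /\<^sub>R norm z)\<bar>"
      by (simp add: abs_mult)
    also have "\<dots> \<le> norm z ^ n * max 0 C"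
      using C[of "z /\<^sub>R norm z"] False z \<open>n \<le> j\<close>
      by (intro mult_mono power_decreasing) auto
    finally show ?thesis by (simp add: mult.commute)
  qed
  then show ?thesis
    by (intro bigoI[of _ "max 0 C"] eventually_nhds_metric[THEN iffD2] exI[of _ 1]) (auto simp: dist_norm)
qed

lemma vanishes_to_order_along_ray:
  assumes "vanishes_to_order n F"
  shows "(\<lambda>t. F (t *\<^sub>R z)) \<in> O[at 0](\<lambda>t. t ^ n)"
proof -
  have "filterlim (\<lambda>t. t *\<^sub>R z) (nhds 0) (at 0)"
    by (auto intro!: tendsto_eq_intros)
  then have "(\<lambda>t. F (t *\<^sub>R z)) \<in> O[at 0](\<lambda>t. norm (t *\<^sub>R z) ^ n)"
    using assms unfolding vanishes_to_order_def by (rule landau_o.big.compose[rotated])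
  also have "(\<lambda>t. norm (t *\<^sub>R z) ^ n) \<in> O[at 0](\<lambda>t. t ^ n)"
    by (intro bigoI[of _ "norm z ^ n"]) (simp add: power_mult_distrib power_abs)
  finally show ?thesis .
qed

text \<open>The form in which orders are compared: the constant coefficient is the limit at 0, and once
  it vanishes a factor \<open>t\<close> can be cancelled.\<close>

lemma poly_coeff_0_of_bigo:
  fixes P :: "real poly"
  assumes "poly P \<in> O[at 0](\<lambda>t. t ^ Suc m)" and "j \<le> m"
  shows "coeff P j = 0"
  using assms
proof (induction m arbitrary: P j)
  case 0
  have "((\<lambda>t. t ^ Suc 0) \<longlongrightarrow> (0::real)) (at 0)"
    by (auto intro!: tendsto_eq_intros)
  then have "(\<lambda>t::real. t ^ Suc 0) \<in> o[at 0](\<lambda>_. 1)"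
    by (intro smalloI_tendsto) auto
  then have "poly P \<in> o[at 0](\<lambda>_. 1)"
    using 0 landau_o.big_small_trans by blast
  then have "(poly P \<longlongrightarrow> 0) (at 0)" using smalloD_tendsto by force
  moreover have "(poly P \<longlongrightarrow> poly P 0) (at 0)"
    by (intro tendsto_intros)
  ultimately have "poly P 0 = 0" using LIM_unique by blast
  then show ?case using 0 by (simp add: poly_0_coeff_0)
next
  case (Suc m)
  have "(\<lambda>t::real. t ^ Suc m * t) \<in> O[at 0](\<lambda>t. t ^ Suc m * 1)"
  proof (rule landau_o.big.mult_left)
    have "((\<lambda>t::real. t) \<longlongrightarrow> 0) (at 0)" by (rule tendsto_ident_at)
    then show "(\<lambda>t::real. t) \<in> O[at 0](\<lambda>_. 1)"
      by (intro bigoI_tendsto[where c = 0]) auto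
  qed
  then have "poly P \<in> O[at 0](\<lambda>t. t ^ Suc m)"
    using Suc.prems landau_o.big_trans by (simp add: mult.commute) blast
  then have P0: "coeff P 0 = 0" using Suc.IH by blast
  obtain Q where P: "P = pCons 0 Q"
    using P0 by (cases P) auto
  have "(\<lambda>t. t * poly Q t) \<in> O[at 0](\<lambda>t. t * t ^ Suc m)"
    using Suc.prems by (simp add: P)
  then have "poly Q \<in> O[at 0](\<lambda>t. t ^ Suc m)"
    by (subst (asm) landau_o.big.mult_cancel_left) (auto simp: eventually_at_filter)
  then show ?case
    using Suc.IH[of Q "j - 1"] Suc.prems P by (cases j) auto
qed

section \<open>The spectral projection\<close>

lemma vector_2_eq: "(vector [a, c] :: real ^ 2) = a *\<^sub>R axis 1 1 + c *\<^sub>R axis 2 1"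
  by (simp add: vec_eq_iff forall_2 axis_def)

lemma inner_basis_row: "basis_row \<theta> \<bullet> x = x $ 1 + \<theta> * x $ 2"
  by (simp add: basis_row_def inner_vec_def sum_2)

lemma B_dagger_nth:
  assumes "continuous_on {-1..0} u"
  shows "B_dagger u $ 1 = 2/3 * u 0 + integral {-1..0} (\<lambda>s. (2 * s + 4/3) * u s)"
    and "B_dagger u $ 2 = 2 * u 0 - 2 * integral {-1..0} u"
proof -
  let ?k = "\<lambda>s. u s *\<^sub>R (vector [2 * s + 4/3, -2] :: real ^ 2)"
  have "?k integrable_on {-1..0}"
    unfolding vector_2_eq
    by (intro integrable_continuous_interval continuous_intros assms)
  note nth = integral_component_eq_cart[OF this]
  show "B_dagger u $ 1 = 2/3 * u 0 + integral {-1..0} (\<lambda>s. (2 * s + 4/3) * u s)"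
    using nth[of 1] by (simp add: B_dagger_def mult.commute)
  show "B_dagger u $ 2 = 2 * u 0 - 2 * integral {-1..0} u"
    using nth[of 2] by (simp add: B_dagger_def mult.commute)
qed

text \<open>The kernel of \<open>B\<^sup>\<dagger>\<close> among functions whose restriction to \<open>[-1, 0]\<close> is continuous. Without
  continuity \<open>B\<^sup>\<dagger>\<close> would not be linear, since \<^const>\<open>integral\<close> is 0 on functions without integral.\<close>

definition null_projection :: "(real \<Rightarrow> real) \<Rightarrow> bool" where
  "null_projection u \<longleftrightarrow> continuous_on {-1..0} u \<and> B_dagger u = 0"

lemma null_projection_iff:
  "null_projection u \<longleftrightarrow> continuous_on {-1..0} u \<and>
     2/3 * u 0 + integral {-1..0} (\<lambda>s. (2 * s + 4/3) * u s) = 0 \<and>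
     u 0 = integral {-1..0} u"
  using B_dagger_nth[of u] by (auto simp: null_projection_def vec_eq_iff forall_2)

lemma null_projection_cong:
  assumes "\<And>\<theta>. \<theta> \<in> {-1..0} \<Longrightarrow> u \<theta> = w \<theta>"
  shows "null_projection u \<longleftrightarrow> null_projection w"
proof -
  have "integral {-1..0} (\<lambda>s. (2 * s + 4/3) * u s) = integral {-1..0} (\<lambda>s. (2 * s + 4/3) * w s)"
    "integral {-1..0} u = integral {-1..0} w"
    using assms by (auto intro: integral_cong)
  moreover have "continuous_on {-1..0} u = continuous_on {-1..0} w"
    using assms by (intro continuous_on_cong) auto
  ultimately show ?thesis
    using assms[of 0] by (simp add: null_projection_iff)
qed

lemma null_projection_comb:
  assumes "null_projection u" "null_projection w"
  shows "null_projection (\<lambda>\<theta>. r * u \<theta> + s * w \<theta>)"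
proof -
  have cont: "continuous_on {-1..0} u" "continuous_on {-1..0} w"
    using assms by (auto simp: null_projection_def)
  have int: "f integrable_on {-1..0}" if "continuous_on {-1..0} f" for f :: "real \<Rightarrow> real"
    using that by (rule integrable_continuous_interval)
  have "integral {-1..0} (\<lambda>\<theta>. r * u \<theta> + s * w \<theta>) = r * integral {-1..0} u + s * integral {-1..0} w"
    using cont by (subst integral_add) (auto intro!: int continuous_intros)
  moreover have "integral {-1..0} (\<lambda>\<theta>. (2 * \<theta> + 4/3) * (r * u \<theta> + s * w \<theta>))
      = integral {-1..0} (\<lambda>\<theta>. r * ((2 * \<theta> + 4/3) * u \<theta>) + s * ((2 * \<theta> + 4/3) * w \<theta>))"
    by (simp add: algebra_simps)
  moreover have "\<dots> = r * integral {-1..0} (\<lambda>\<theta>. (2 * \<theta> + 4/3) * u \<theta>)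
      + s * integral {-1..0} (\<lambda>\<theta>. (2 * \<theta> + 4/3) * w \<theta>)"
    using cont by (subst integral_add) (auto intro!: int continuous_intros)
  moreover have "continuous_on {-1..0} (\<lambda>\<theta>. r * u \<theta> + s * w \<theta>)"
    by (intro continuous_intros cont)
  moreover have "2/3 * (r * u 0 + s * w 0) + (r * integral {-1..0} (\<lambda>\<theta>. (2 * \<theta> + 4/3) * u \<theta>)
      + s * integral {-1..0} (\<lambda>\<theta>. (2 * \<theta> + 4/3) * w \<theta>)) = 0"
  proof -
    have "2/3 * u 0 + integral {-1..0} (\<lambda>\<theta>. (2 * \<theta> + 4/3) * u \<theta>) = 0"
      "2/3 * w 0 + integral {-1..0} (\<lambda>\<theta>. (2 * \<theta> + 4/3) * w \<theta>) = 0"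
      using assms unfolding null_projection_iff by blast+
    then show ?thesis by algebra
  qed
  moreover have "u 0 = integral {-1..0} u" "w 0 = integral {-1..0} w"
    using assms unfolding null_projection_iff by blast+
  ultimately show ?thesis
    unfolding null_projection_iff by (simp only: simp_thms)
qed

lemma null_projection_zero: "null_projection (\<lambda>_. 0)"
  by (simp add: null_projection_iff)

lemma null_projection_sum:
  assumes "\<And>i. i \<in> I \<Longrightarrow> null_projection (u i)"
  shows "null_projection (\<lambda>\<theta>. \<Sum>i\<in>I. u i \<theta>)"
  using assms
proof (induction I rule: infinite_finite_induct)
  case (insert i I)
  then have "null_projection (\<lambda>\<theta>. 1 * u i \<theta> + 1 * (\<Sum>i\<in>I. u i \<theta>))"
    by (intro null_projection_comb) auto
  then show ?case using insert by simp
qed (auto simp: null_projection_zero)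

text \<open>Here \<open>c = B\<^sup>\<dagger> u'\<close>, as \<open>B\<^sup>\<dagger>\<close> kills \<open>g\<close> and inverts \<open>B\<close>. The direction \<open>(2/3, 2)\<close> comes
  from integrating by parts against the affine weights of \<open>B\<^sup>\<dagger>\<close>: no integral remains but
  \<open>\<integral> u\<close>, which equals \<open>u 0\<close> by the second component of \<open>B\<^sup>\<dagger> u = 0\<close>, and both components collapse
  to a multiple of the residual \<open>u' 0 - u 0 + u (-1)\<close> of the linearized delay equation. In the proof
  the integrals of \<open>u'\<close> and of \<open>((2 s + 4/3) u)'\<close> are each computed twice, by the fundamental
  theorem and from the splitting of \<open>u'\<close>.\<close>

lemma basis_coordinates_of_derivative:
  assumes u: "\<And>\<theta>. \<theta> \<in> {-1..0} \<Longrightarrow> (u has_real_derivative u' \<theta>) (at \<theta> within {-1..0})"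
    and split: "\<And>\<theta>. \<theta> \<in> {-1..0} \<Longrightarrow> u' \<theta> = basis_row \<theta> \<bullet> c + g \<theta>"
    and nu: "null_projection u" and ng: "null_projection g"
  shows "c = (u' 0 - u 0 + u (-1)) *\<^sub>R vector [2/3, 2]"
proof -
  have cont: "continuous_on {-1..0} u" "continuous_on {-1..0} g"
    using nu ng by (auto simp: null_projection_def)
  have hi: "(f has_integral integral {-1..0} f) {-1..0}" if "continuous_on {-1..0} f" for f :: "real \<Rightarrow> real"
    using that by (intro integrable_integral integrable_continuous_interval)
  have ftc: "(f' has_integral f 0 - f (-1)) {-1..0}"
    if "\<And>\<theta>. \<theta> \<in> {-1..0} \<Longrightarrow> (f has_real_derivative f' \<theta>) (at \<theta> within {-1..0})" for f f' :: "real \<Rightarrow> real"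
    using that by (intro fundamental_theorem_of_calculus) (auto simp: has_real_derivative_iff_has_vector_derivative)
  have "(u' has_integral u 0 - u (-1)) {-1..0}"
    using u by (rule ftc)
  moreover have "((\<lambda>s. c $ 1 + s * c $ 2) has_integral c $ 1 - c $ 2 / 2) {-1..0}"
    by (rule has_integral_eq_rhs[OF ftc[of "\<lambda>s. c $ 1 * s + c $ 2 * s\<^sup>2 / 2"]])
      (auto intro!: derivative_eq_intros)
  then have "((\<lambda>s. (c $ 1 + s * c $ 2) + g s) has_integral (c $ 1 - c $ 2 / 2) + integral {-1..0} g) {-1..0}"
    by (intro has_integral_add hi cont)
  then have "(u' has_integral (c $ 1 - c $ 2 / 2) + integral {-1..0} g) {-1..0}"
    by (rule has_integral_eq[rotated]) (simp add: split inner_basis_row)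
  ultimately have 1: "u 0 - u (-1) = c $ 1 - c $ 2 / 2 + integral {-1..0} g"
    by (rule has_integral_unique)
  have "((\<lambda>s. 2 * u s + (2 * s + 4/3) * u' s) has_integral
      (2 * 0 + 4/3) * u 0 - (2 * (-1) + 4/3) * u (-1)) {-1..0}"
    by (rule ftc[of "\<lambda>s. (2 * s + 4/3) * u s"]) (auto intro!: derivative_eq_intros u)
  moreover have "((\<lambda>s. (2 * s + 4/3) * (c $ 1 + s * c $ 2)) has_integral c $ 1 / 3) {-1..0}"
    by (rule has_integral_eq_rhs[OF ftc[of "\<lambda>s. 2/3 * c $ 2 * s ^ 3 + (c $ 1 + 2/3 * c $ 2) * s\<^sup>2 + 4/3 * c $ 1 * s"]])
      (auto intro!: derivative_eq_intros simp: algebra_simps power2_eq_square)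
  then have "((\<lambda>s. 2 * u s + ((2 * s + 4/3) * (c $ 1 + s * c $ 2) + (2 * s + 4/3) * g s)) has_integral
      2 * integral {-1..0} u + (c $ 1 / 3 + integral {-1..0} (\<lambda>s. (2 * s + 4/3) * g s))) {-1..0}"
    using cont by (intro has_integral_add has_integral_mult_right hi) (auto intro!: continuous_intros)
  then have "((\<lambda>s. 2 * u s + (2 * s + 4/3) * u' s) has_integral
      2 * integral {-1..0} u + (c $ 1 / 3 + integral {-1..0} (\<lambda>s. (2 * s + 4/3) * g s))) {-1..0}"
    by (rule has_integral_eq[rotated]) (simp add: split inner_basis_row algebra_simps)
  ultimately have 2: "(2 * 0 + 4/3) * u 0 - (2 * (-1) + 4/3) * u (-1)
      = 2 * integral {-1..0} u + (c $ 1 / 3 + integral {-1..0} (\<lambda>s. (2 * s + 4/3) * g s))"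
    by (rule has_integral_unique)
  have "u 0 = integral {-1..0} u" "g 0 = integral {-1..0} g"
    "2/3 * g 0 + integral {-1..0} (\<lambda>s. (2 * s + 4/3) * g s) = 0" "u' 0 = c $ 1 + g 0"
    using nu ng split[of 0] by (auto simp: null_projection_iff inner_basis_row)
  note eqs = 1 2 this
  have "c $ 1 = (u' 0 - u 0 + u (-1)) * (2/3)" using eqs by argo
  moreover have "c $ 2 = (u' 0 - u 0 + u (-1)) * 2" using eqs by argo
  ultimately show ?thesis
    by (simp add: vec_eq_iff forall_2)
qed

section \<open>Derivatives in the state variable\<close>

text \<open>Derivative in direction \<open>v\<close> of the state alone; the parameters have velocity 0.\<close>

definition xderiv :: "(state \<Rightarrow> real) \<Rightarrow> state \<Rightarrow> real ^ 2 \<Rightarrow> real" where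
  "xderiv F z v = frechet_derivative F (at z) (v, 0)"

lemma linear_xderiv:
  assumes "F differentiable at z"
  shows "linear (xderiv F z)"
proof -
  have "linear (frechet_derivative F (at z) \<circ> (\<lambda>v. (v, 0)))"
    using assms by (intro linear_compose linear_frechet_derivative) (auto intro!: linearI)
  then show ?thesis by (simp add: xderiv_def[abs_def] o_def)
qed

lemma has_derivative_xderiv:
  assumes "F differentiable at (x, p, q)"
  shows "((\<lambda>x'. F (x', p, q)) has_derivative xderiv F (x, p, q)) (at x)"
proof -
  have "((\<lambda>x'. F (x', p, q)) has_derivative
      (\<lambda>v. frechet_derivative F (at (x, p, q)) (v, 0))) (at x)"
  proof (rule has_derivative_compose[of "\<lambda>x'. (x', p, q)"])
    show "((\<lambda>x'. (x', p, q)) has_derivative (\<lambda>v. (v, 0))) (at x)"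
      by (auto intro!: derivative_eq_intros simp: zero_prod_def)
    show "(F has_derivative frechet_derivative F (at (x, p, q))) (at (x, p, q))"
      using assms by (simp add: frechet_derivative_works)
  qed
  then show ?thesis by (simp add: xderiv_def[abs_def])
qed

lemma xderiv_homogeneous:
  assumes diff: "\<And>z. F differentiable at z"
    and hom: "\<And>t z. F (t *\<^sub>R z) = t ^ Suc n * F z" and "t \<noteq> 0"
  shows "xderiv F (t *\<^sub>R z) v = t ^ n * xderiv F z v"
proof -
  have F: "(F has_derivative frechet_derivative F (at y)) (at y)" for y
    using diff by (simp add: frechet_derivative_works)
  have "((\<lambda>z. F (t *\<^sub>R z)) has_derivative (\<lambda>v. frechet_derivative F (at (t *\<^sub>R z)) (t *\<^sub>R v))) (at z)"
    by (rule has_derivative_compose[of "\<lambda>z. t *\<^sub>R z", OF _ F]) (auto intro!: derivative_eq_intros)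
  moreover have "((\<lambda>z. F (t *\<^sub>R z)) has_derivative (\<lambda>v. t ^ Suc n * frechet_derivative F (at z) v)) (at z)"
    unfolding hom by (intro has_derivative_mult_right F)
  ultimately have "frechet_derivative F (at (t *\<^sub>R z)) (t *\<^sub>R (v, 0))
      = t ^ Suc n * frechet_derivative F (at z) (v, 0)"
    by (metis has_derivative_unique)
  moreover have "frechet_derivative F (at (t *\<^sub>R z)) (t *\<^sub>R (v, 0))
      = t * frechet_derivative F (at (t *\<^sub>R z)) (v, 0)"
    by (simp only: linear_scale[OF linear_frechet_derivative[OF diff]] real_scaleR_def)
  ultimately show ?thesis using \<open>t \<noteq> 0\<close> by (simp add: xderiv_def)
qed

lemma xderiv_eq_linear_coefficient:
  assumes diff: "F differentiable at z" and "1 \<le> n"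
    and line: "\<And>s. F (z + s *\<^sub>R (v, 0)) = (\<Sum>i\<le>n. c i * s ^ i)"
  shows "xderiv F z v = c 1"
proof -
  have "((\<lambda>s. F (z + s *\<^sub>R (v, 0))) has_derivative
      (\<lambda>s. frechet_derivative F (at z) (s *\<^sub>R (v, 0)))) (at 0)"
  proof (rule has_derivative_compose[of "\<lambda>s. z + s *\<^sub>R (v, 0)"])
    show "((\<lambda>s. z + s *\<^sub>R (v, 0)) has_derivative (\<lambda>s. s *\<^sub>R (v, 0))) (at 0)"
      by (auto intro!: derivative_eq_intros)
    show "(F has_derivative frechet_derivative F (at z)) (at (z + 0 *\<^sub>R (v, 0)))"
      using diff by (simp add: frechet_derivative_works flip: zero_prod_def)
  qed
  then have "((\<lambda>s. F (z + s *\<^sub>R (v, 0))) has_real_derivative xderiv F z v) (at 0)"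
    by (simp only: linear_scale[OF linear_frechet_derivative[OF diff]] has_field_derivative_def
        xderiv_def real_scaleR_def mult.commute[of _ "frechet_derivative F (at z) (v, 0)"])
  moreover have "((\<lambda>s. \<Sum>i\<le>n. c i * s ^ i) has_real_derivative
      (\<Sum>i\<le>n. c i * (of_nat i * 0 ^ (i - 1)))) (at 0)"
    by (auto intro!: derivative_eq_intros sum.cong)
  moreover have "(\<Sum>i\<le>n. c i * (of_nat i * 0 ^ (i - 1))) = (\<Sum>i\<le>n. if i = 1 then c i else 0)"
    by (intro sum.cong) (auto simp: power_0_left)
  moreover have "\<dots> = c 1" using \<open>1 \<le> n\<close> by simp
  ultimately show ?thesis
    unfolding line by (metis DERIV_unique)
qed

lemma symmetric_multilinear_imp_multilinear_form:
  "symmetric_multilinear j M \<Longrightarrow> multilinear_form j M"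
  by (simp add: symmetric_multilinear_def multilinear_form_def)

lemma symmetric_multilinear_nth:
  fixes M :: "(nat \<Rightarrow> 'a::real_vector) \<Rightarrow> real ^ 'n"
  assumes "symmetric_multilinear j M"
  shows "multilinear_form j (\<lambda>v. M v $ k)"
proof -
  have "linear (\<lambda>x. M (v(i := x)) $ k)" if "i < j" for v i
    using linear_compose[of "\<lambda>x. M (v(i := x))" "\<lambda>y::real^'n. y $ k"] assms that
    by (auto simp: symmetric_multilinear_def o_def linear_iff)
  moreover have "M v $ k = M w $ k" if "\<forall>i<j. v i = w i" for v w
    using assms that unfolding symmetric_multilinear_def by metis
  ultimately show ?thesis by (auto simp: multilinear_form_def)
qed

section \<open>The double zero eigenvalue\<close>

text \<open>To first order the state-dependent delay is invisible: it multiplies a factor that is already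
  \<open>O(\<epsilon>)\<close>, so only continuity of \<open>\<phi>\<close> at the constant delay matters.\<close>

lemma linearization_dde_rhs:
  assumes cont: "isCont \<phi> (-1)"
  shows "linearization (dde_rhs b p q) \<phi> = alpha_beta p q $ 1 * \<phi> 0 + alpha_beta p q $ 2 * \<phi> (-1)"
proof -
  let ?a = "alpha_beta p q $ 1" and ?c = "alpha_beta p q $ 2"
  have "((\<lambda>\<epsilon>. -1 - \<epsilon> * \<phi> (-b)) \<longlongrightarrow> -1) (at 0)"
    by (auto intro!: tendsto_eq_intros)
  then have "((\<lambda>\<epsilon>. ?a * \<phi> 0 + ?c * \<phi> (-1 - \<epsilon> * \<phi> (-b))) \<longlongrightarrow> ?a * \<phi> 0 + ?c * \<phi> (-1)) (at 0)"
    by (intro tendsto_intros isCont_tendsto_compose[OF cont])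
  then have "((\<lambda>\<epsilon>. dde_rhs b p q (\<lambda>\<theta>. \<epsilon> * \<phi> \<theta>)) has_real_derivative ?a * \<phi> 0 + ?c * \<phi> (-1)) (at 0)"
    unfolding DERIV_def
    by (rule Lim_transform_eventually) (auto simp: dde_rhs_def eventually_at_filter field_simps)
  then show ?thesis
    unfolding linearization_def by (rule DERIV_imp_deriv)
qed

lemma char_fun_at_bifurcation:
  "char_fun (linearization (dde_rhs b 0 0)) = (\<lambda>z. z - 1 + exp (- z))"
proof
  fix z :: complex
  have ab: "alpha_beta 0 0 $ 1 = 1" "alpha_beta 0 0 $ 2 = -1"
    by (simp_all add: alpha_beta_def matrix_vector_mult_def sum_2)
  have "isCont (\<lambda>\<theta>::real. Re (exp (z * of_real \<theta>))) (-1)" "isCont (\<lambda>\<theta>::real. Im (exp (z * of_real \<theta>))) (-1)"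
    by (rule continuous_Re continuous_Im, intro continuous_intros)+
  then show "char_fun (linearization (dde_rhs b 0 0)) z = z - 1 + exp (- z)"
    unfolding char_fun_def by (simp add: linearization_dde_rhs ab complex_eq_iff)
qed

lemma zorder_char_fun:
  "zorder (char_fun (linearization (dde_rhs b 0 0))) 0 = 2"
  unfolding char_fun_at_bifurcation
proof (rule zorder_zero_eqI)
  let ?f = "\<lambda>z::complex. z - 1 + exp (- z)"
  have 1: "deriv ?f = (\<lambda>z. 1 - exp (- z))"
    by (rule ext, rule DERIV_imp_deriv) (auto intro!: derivative_eq_intros)
  have 2: "deriv (\<lambda>z::complex. 1 - exp (- z)) = (\<lambda>z. exp (- z))"
    by (rule ext, rule DERIV_imp_deriv) (auto intro!: derivative_eq_intros)
  show "?f holomorphic_on UNIV" by (intro holomorphic_intros)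
  show "(deriv ^^ i) ?f 0 = 0" if "i < nat 2" for i
  proof -
    have "i = 0 \<or> i = 1" using that by auto
    then show ?thesis by (auto simp: 1)
  qed
  show "(deriv ^^ nat 2) ?f 0 \<noteq> 0"
    by (simp add: numeral_2_eq_2 1 2)
qed auto

section \<open>The change of coordinates\<close>

lemma T_mat_nth: "(T_mat *v y) $ 1 = y $ 1 + y $ 2 / 3" "(T_mat *v y) $ 2 = y $ 2"
  by (simp_all add: T_mat_def matrix_vector_mult_def sum_2)

lemma T_mat_inverse_nth:
  "(matrix_inv T_mat *v x) $ 1 = x $ 1 - x $ 2 / 3"
  "(matrix_inv T_mat *v x) $ 2 = x $ 2"
proof -
  let ?S = "vector [vector [1, -1/3], vector [0, 1]] :: real ^ 2 ^ 2"
  have S: "T_mat ** ?S = mat 1" "?S ** T_mat = mat 1"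
    by (simp_all add: T_mat_def matrix_matrix_mult_def mat_def vec_eq_iff forall_2 sum_2)
  then have "\<exists>M. T_mat ** M = mat 1 \<and> M ** T_mat = mat 1"
    by blast
  then have "T_mat ** matrix_inv T_mat = mat 1 \<and> matrix_inv T_mat ** T_mat = mat 1"
    unfolding matrix_inv_def by (rule someI_ex)
  then have "?S ** (T_mat ** matrix_inv T_mat) = ?S"
    by (simp add: matrix_mul_rid)
  then have inv: "matrix_inv T_mat = ?S"
    by (simp only: matrix_mul_assoc S matrix_mul_lid)
  show "(matrix_inv T_mat *v x) $ 1 = x $ 1 - x $ 2 / 3" "(matrix_inv T_mat *v x) $ 2 = x $ 2"
    by (simp_all add: inv matrix_vector_mult_def sum_2)
qed

section \<open>The invariance equations order by order\<close>

locale center_manifold_expansion =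
  fixes \<tau> b :: real and m :: nat
    and h :: "nat \<Rightarrow> real \<Rightarrow> (nat \<Rightarrow> state) \<Rightarrow> real"
    and A :: "nat \<Rightarrow> (nat \<Rightarrow> state) \<Rightarrow> real ^ 2"
  assumes b_ge_0: "b \<ge> 0" and one_less_tau: "\<tau> > 1" and b_less_tau: "\<tau> > b"
    and two_le_m: "m \<ge> 2" and expansion: "cm_expansion \<tau> b m h A"
begin

lemma expansion_coefficients:
  assumes "j \<in> {2..m}"
  shows h_multilinear: "\<theta> \<in> {-\<tau>..0} \<Longrightarrow> symmetric_multilinear j (h j \<theta>)"
    and A_multilinear: "symmetric_multilinear j (A j)"
    and h_differentiable: "(\<lambda>\<theta>. h j \<theta> (\<lambda>_. z)) differentiable_on {-\<tau>..0}"
    and B_dagger_h: "B_dagger (\<lambda>\<theta>. h j \<theta> (\<lambda>_. z)) = 0"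
  using assms expansion unfolding cm_expansion_def by blast+

lemma invariance_residual:
  assumes "\<theta> \<in> {-\<tau>..0}"
  shows "vanishes_to_order (m + 1) (\<lambda>(x, p, q).
      frechet_derivative (\<lambda>x'. cm_graph m h (x', p, q) \<theta>) (at x) (cm_field m A (x, p, q)) -
      vector_derivative (cm_graph m h (x, p, q)) (at \<theta> within {-\<tau>..0}))"
  using assms expansion unfolding cm_expansion_def by blast

lemma delay_equation_residual:
  "vanishes_to_order (m + 1) (\<lambda>(x, p, q).
     vector_derivative (cm_graph m h (x, p, q)) (at 0 within {-\<tau>..0}) -
     dde_rhs b p q (cm_graph m h (x, p, q)))"
  using expansion unfolding cm_expansion_def by blast

text \<open>The linear terms \<open>B x\<^sub>c\<close> and \<open>J\<^sub>0 x\<^sub>c\<close> count as the coefficients of order 1, so that the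
  graph and the vector field become uniform sums over the orders from 1 to \<open>m\<close>.\<close>

definition graph_form :: "nat \<Rightarrow> real \<Rightarrow> (nat \<Rightarrow> state) \<Rightarrow> real" where
  "graph_form j \<theta> = (if j = 1 then (\<lambda>v. basis_row \<theta> \<bullet> fst (v 0)) else h j \<theta>)"

definition graph_coeff :: "nat \<Rightarrow> real \<Rightarrow> state \<Rightarrow> real" where
  "graph_coeff j \<theta> z = graph_form j \<theta> (\<lambda>_. z)"

definition field_coeff :: "nat \<Rightarrow> state \<Rightarrow> real ^ 2" where
  "field_coeff j z = (if j = 1 then J0 *v fst z else A j (\<lambda>_. z))"

lemma graph_form_multilinear:
  assumes "j \<in> {1..m}" "\<theta> \<in> {-\<tau>..0}"
  shows "multilinear_form j (graph_form j \<theta>)"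
proof (cases "j = 1")
  case True
  then show ?thesis
    by (auto simp: graph_form_def multilinear_form_def linear_iff inner_add_right)
next
  case False
  then show ?thesis
    using assms h_multilinear[of j \<theta>]
    by (simp add: graph_form_def symmetric_multilinear_imp_multilinear_form)
qed

lemma graph_coeff_homogeneous:
  assumes "j \<in> {1..m}" "\<theta> \<in> {-\<tau>..0}"
  shows "graph_coeff j \<theta> (t *\<^sub>R z) = t ^ j * graph_coeff j \<theta> z"
  using multilinear_form_homogeneous[OF graph_form_multilinear[OF assms]]
  by (simp add: graph_coeff_def)

lemma graph_coeff_differentiable:
  assumes "j \<in> {1..m}" "\<theta> \<in> {-\<tau>..0}"
  shows "graph_coeff j \<theta> differentiable at z"
  using multilinear_form_real_polynomial[OF graph_form_multilinear[OF assms]]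
  unfolding graph_coeff_def[abs_def]
  by (simp add: differentiable_at_real_polynomial_function)

lemma A_component_multilinear:
  assumes "j \<in> {2..m}"
  shows "multilinear_form j (\<lambda>v. A j v $ k)"
  by (intro symmetric_multilinear_nth A_multilinear assms)

lemma field_coeff_homogeneous:
  assumes "j \<in> {1..m}"
  shows "field_coeff j (t *\<^sub>R z) = t ^ j *\<^sub>R field_coeff j z"
proof (cases "j = 1")
  case True
  then show ?thesis by (simp add: field_coeff_def matrix_vector_mult_scaleR)
next
  case False
  then have "j \<in> {2..m}" using assms by auto
  then show ?thesis
    using False multilinear_form_homogeneous[OF A_component_multilinear]
    by (simp add: field_coeff_def vec_eq_iff)
qed

lemma cm_graph_eq: "cm_graph m h z \<theta> = (\<Sum>j=1..m. graph_coeff j \<theta> z)"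
proof -
  have "(\<Sum>j=1..m. graph_coeff j \<theta> z) = graph_coeff 1 \<theta> z + (\<Sum>j=2..m. graph_coeff j \<theta> z)"
    using two_le_m by (subst sum.atLeast_Suc_atMost) (auto simp: numeral_2_eq_2)
  also have "(\<Sum>j=2..m. graph_coeff j \<theta> z) = (\<Sum>j=2..m. h j \<theta> (\<lambda>_. z))"
    by (intro sum.cong) (auto simp: graph_coeff_def graph_form_def)
  finally show ?thesis by (simp add: cm_graph_def graph_coeff_def graph_form_def)
qed

lemma cm_field_eq: "cm_field m A z = (\<Sum>j=1..m. field_coeff j z)"
proof -
  have "(\<Sum>j=1..m. field_coeff j z) = field_coeff 1 z + (\<Sum>j=2..m. field_coeff j z)"
    using two_le_m by (subst sum.atLeast_Suc_atMost) (auto simp: numeral_2_eq_2)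
  also have "(\<Sum>j=2..m. field_coeff j z) = (\<Sum>j=2..m. A j (\<lambda>_. z))"
    by (intro sum.cong) (auto simp: field_coeff_def)
  finally show ?thesis by (simp add: cm_field_def field_coeff_def)
qed

text \<open>The derivative in \<open>\<theta>\<close> of the coefficient of order \<open>j\<close>, one-sided at the end points.\<close>

definition graph_slope :: "nat \<Rightarrow> real \<Rightarrow> state \<Rightarrow> real" where
  "graph_slope j \<theta> z = vector_derivative (\<lambda>\<theta>. graph_coeff j \<theta> z) (at \<theta> within {-\<tau>..0})"

lemma at_within_history: "\<theta> \<in> {-\<tau>..0} \<Longrightarrow> at \<theta> within {-\<tau>..0} \<noteq> bot"
  using one_less_tau by (simp add: trivial_limit_within islimpt_Icc)

lemma graph_coeff_has_slope:
  assumes "j \<in> {1..m}" "\<theta> \<in> {-\<tau>..0}"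
  shows "((\<lambda>\<theta>. graph_coeff j \<theta> z) has_vector_derivative graph_slope j \<theta> z) (at \<theta> within {-\<tau>..0})"
proof -
  have "(\<lambda>\<theta>. graph_coeff j \<theta> z) differentiable at \<theta> within {-\<tau>..0}"
  proof (cases "j = 1")
    case True
    have "((\<lambda>\<theta>. fst z $ 1 + \<theta> * fst z $ 2) has_real_derivative fst z $ 2) (at \<theta> within {-\<tau>..0})"
      by (auto intro!: derivative_eq_intros)
    then show ?thesis
      using True by (auto simp: graph_coeff_def graph_form_def inner_basis_row
          intro: differentiableI has_field_derivative_imp_has_derivative)
  next
    case False
    then have "(\<lambda>\<theta>. h j \<theta> (\<lambda>_. z)) differentiable_on {-\<tau>..0}"
      using assms by (intro h_differentiable) auto
    then show ?thesis
      using False assms by (simp add: graph_coeff_def graph_form_def differentiable_on_def)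
  qed
  then show ?thesis
    using vector_derivative_works by (auto simp: graph_slope_def)
qed

lemma graph_slope_unique:
  assumes "((\<lambda>\<theta>. graph_coeff j \<theta> z) has_vector_derivative s) (at \<theta> within {-\<tau>..0})"
    and "\<theta> \<in> {-\<tau>..0}"
  shows "graph_slope j \<theta> z = s"
  unfolding graph_slope_def
  using assms at_within_history by (intro vector_derivative_within)

lemma graph_slope_1:
  assumes "\<theta> \<in> {-\<tau>..0}"
  shows "graph_slope 1 \<theta> z = fst z $ 2"
proof (rule graph_slope_unique[OF _ assms])
  have "((\<lambda>\<theta>. fst z $ 1 + \<theta> * fst z $ 2) has_real_derivative fst z $ 2) (at \<theta> within {-\<tau>..0})"
    by (auto intro!: derivative_eq_intros)
  then show "((\<lambda>\<theta>. graph_coeff 1 \<theta> z) has_vector_derivative fst z $ 2) (at \<theta> within {-\<tau>..0})"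
    by (simp add: graph_coeff_def graph_form_def inner_basis_row has_real_derivative_iff_has_vector_derivative)
qed

lemma graph_slope_homogeneous:
  assumes "j \<in> {1..m}" "\<theta> \<in> {-\<tau>..0}"
  shows "graph_slope j \<theta> (t *\<^sub>R z) = t ^ j * graph_slope j \<theta> z"
proof (rule graph_slope_unique[OF _ assms(2)])
  have "((\<lambda>\<theta>. t ^ j * graph_coeff j \<theta> z) has_vector_derivative t ^ j * graph_slope j \<theta> z)
      (at \<theta> within {-\<tau>..0})"
    by (intro has_vector_derivative_mult_right graph_coeff_has_slope assms)
  then show "((\<lambda>\<theta>. graph_coeff j \<theta> (t *\<^sub>R z)) has_vector_derivative t ^ j * graph_slope j \<theta> z)
      (at \<theta> within {-\<tau>..0})"
    by (rule has_vector_derivative_transform[OF assms(2), rotated])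
      (simp add: graph_coeff_homogeneous[OF assms(1)])
qed

lemma cm_graph_slope:
  assumes "\<theta> \<in> {-\<tau>..0}"
  shows "vector_derivative (cm_graph m h z) (at \<theta> within {-\<tau>..0}) = (\<Sum>j=1..m. graph_slope j \<theta> z)"
proof -
  have "((\<lambda>\<theta>. \<Sum>j=1..m. graph_coeff j \<theta> z) has_vector_derivative (\<Sum>j=1..m. graph_slope j \<theta> z))
      (at \<theta> within {-\<tau>..0})"
    by (intro has_vector_derivative_sum graph_coeff_has_slope assms)
  then show ?thesis
    using at_within_history[OF assms]
    by (simp add: cm_graph_eq[abs_def] vector_derivative_within)
qed

lemma cm_graph_xderiv:
  assumes "\<theta> \<in> {-\<tau>..0}"
  shows "frechet_derivative (\<lambda>x'. cm_graph m h (x', p, q) \<theta>) (at x) v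
    = (\<Sum>k=1..m. xderiv (graph_coeff k \<theta>) (x, p, q) v)"
proof -
  have "((\<lambda>x'. \<Sum>k=1..m. graph_coeff k \<theta> (x', p, q)) has_derivative
      (\<lambda>v. \<Sum>k=1..m. xderiv (graph_coeff k \<theta>) (x, p, q) v)) (at x)"
    by (intro has_derivative_sum has_derivative_xderiv graph_coeff_differentiable assms)
  then have "(\<lambda>v. \<Sum>k=1..m. xderiv (graph_coeff k \<theta>) (x, p, q) v)
      = frechet_derivative (\<lambda>x'. cm_graph m h (x', p, q) \<theta>) (at x)"
    unfolding cm_graph_eq by (rule frechet_derivative_at)
  then show ?thesis by metis
qed

text \<open>Differentiating lowers the degree of a graph coefficient by one, so the product of graph
  order \<open>k\<close> with vector field order \<open>l\<close> has order \<open>k - 1 + l\<close>.\<close>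

lemma invariance_coefficients:
  assumes j: "j \<in> {1..m}" and \<theta>: "\<theta> \<in> {-\<tau>..0}"
  shows "graph_slope j \<theta> z = (\<Sum>k=1..m. \<Sum>l=1..m.
     if k - 1 + l = j then xderiv (graph_coeff k \<theta>) z (field_coeff l z) else 0)"
proof -
  (* The residual at t z is this polynomial in t, so orders can be compared by its coefficients. *)
  define P where "P = (\<Sum>k=1..m. \<Sum>l=1..m.
      monom (xderiv (graph_coeff k \<theta>) z (field_coeff l z)) (k - 1 + l)) - (\<Sum>j=1..m. monom (graph_slope j \<theta> z) j)"
  let ?R = "\<lambda>(x, p, q). frechet_derivative (\<lambda>x'. cm_graph m h (x', p, q) \<theta>) (at x) (cm_field m A (x, p, q)) -
        vector_derivative (cm_graph m h (x, p, q)) (at \<theta> within {-\<tau>..0})"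
  have "?R (t *\<^sub>R z) = poly P t" if t: "t \<noteq> 0" for t
  proof -
    have "xderiv (graph_coeff k \<theta>) (t *\<^sub>R z) (cm_field m A (t *\<^sub>R z))
       = (\<Sum>l=1..m. t ^ (k - 1 + l) * xderiv (graph_coeff k \<theta>) z (field_coeff l z))"
      if k: "k \<in> {1..m}" for k
    proof -
      note diff = graph_coeff_differentiable[OF k \<theta>]
      have "xderiv (graph_coeff k \<theta>) (t *\<^sub>R z) (cm_field m A (t *\<^sub>R z))
          = t ^ (k - 1) * xderiv (graph_coeff k \<theta>) z (cm_field m A (t *\<^sub>R z))"
        using k by (intro xderiv_homogeneous diff t) (simp add: graph_coeff_homogeneous[OF _ \<theta>])
      moreover have "cm_field m A (t *\<^sub>R z) = (\<Sum>l=1..m. t ^ l *\<^sub>R field_coeff l z)"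
        unfolding cm_field_eq by (intro sum.cong refl field_coeff_homogeneous)
      ultimately show ?thesis
        by (simp add: linear_sum[OF linear_xderiv[OF diff]] linear_scale[OF linear_xderiv[OF diff]]
            sum_distrib_left power_add mult.assoc)
    qed
    moreover have "?R (t *\<^sub>R z) = (\<Sum>k=1..m. xderiv (graph_coeff k \<theta>) (t *\<^sub>R z) (cm_field m A (t *\<^sub>R z)))
        - (\<Sum>j=1..m. graph_slope j \<theta> (t *\<^sub>R z))"
      by (cases z) (simp add: cm_graph_xderiv[OF \<theta>] cm_graph_slope[OF \<theta>])
    ultimately have "?R (t *\<^sub>R z) =
        (\<Sum>k=1..m. \<Sum>l=1..m. t ^ (k - 1 + l) * xderiv (graph_coeff k \<theta>) z (field_coeff l z))
        - (\<Sum>j=1..m. t ^ j * graph_slope j \<theta> z)"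
      by (simp add: graph_slope_homogeneous[OF _ \<theta>] del: scaleR_prod_def)
    then show ?thesis
      by (simp add: P_def poly_sum poly_monom mult.commute)
  qed
  then have "eventually (\<lambda>t. ?R (t *\<^sub>R z) = poly P t) (at 0)"
    by (simp add: eventually_at_filter)
  moreover have "(\<lambda>t. ?R (t *\<^sub>R z)) \<in> O[at 0](\<lambda>t. t ^ (m + 1))"
    by (rule vanishes_to_order_along_ray[OF invariance_residual[OF \<theta>]])
  ultimately have "poly P \<in> O[at 0](\<lambda>t. t ^ Suc m)"
    using landau_o.big.in_cong by fastforce
  then have "coeff P j = 0"
    using j by (intro poly_coeff_0_of_bigo) auto
  then show ?thesis
    using j by (simp add: P_def coeff_sum)
qed

lemma history_subset: "{-1..0} \<subseteq> {-\<tau>..0}"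
  using one_less_tau by auto

lemma graph_coeff_continuous:
  assumes "j \<in> {1..m}"
  shows "continuous_on {-\<tau>..0} (\<lambda>\<theta>. graph_coeff j \<theta> z)"
  using graph_coeff_has_slope[OF assms]
  by (meson continuous_on_eq_continuous_within has_vector_derivative_continuous)

lemma null_projection_graph_coeff:
  assumes "j \<in> {2..m}"
  shows "null_projection (\<lambda>\<theta>. graph_coeff j \<theta> z)"
proof -
  have "B_dagger (\<lambda>\<theta>. graph_coeff j \<theta> z) = 0"
    using assms B_dagger_h[OF assms] by (simp add: graph_coeff_def graph_form_def)
  moreover have "continuous_on {-1..0} (\<lambda>\<theta>. graph_coeff j \<theta> z)"
    using assms by (intro continuous_on_subset[OF graph_coeff_continuous history_subset]) auto
  ultimately show ?thesis by (simp add: null_projection_def)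
qed

text \<open>The orthogonality condition passes to derivatives in the state: on the line through \<open>z\<close> in
  direction \<open>v\<close> the coefficient is, for all \<open>\<theta>\<close> at once, a polynomial curve of degree at most \<open>k\<close>
  in the kernel of \<open>B\<^sup>\<dagger>\<close>, and the derivative is its linear coefficient.\<close>

lemma null_projection_xderiv:
  assumes k: "k \<in> {2..m}"
  shows "null_projection (\<lambda>\<theta>. xderiv (graph_coeff k \<theta>) z v)"
proof -
  have k1: "k \<in> {1..m}" using k by auto
  have "\<forall>\<theta>\<in>{-\<tau>..0}. \<exists>c. \<forall>s. graph_coeff k \<theta> (z + s *\<^sub>R (v, 0)) = (\<Sum>i\<le>k. c i * s ^ i)"
    unfolding graph_coeff_def
    using multilinear_form_polynomial_on_line[OF graph_form_multilinear[OF k1]] by blast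
  then obtain c where c: "\<And>\<theta> s. \<theta> \<in> {-\<tau>..0} \<Longrightarrow>
      graph_coeff k \<theta> (z + s *\<^sub>R (v, 0)) = (\<Sum>i\<le>k. c \<theta> i * s ^ i)"
    by metis
  have "null_projection (\<lambda>\<theta>. \<Sum>i\<le>k. c \<theta> i * s ^ i)" for s
  proof -
    have "null_projection (\<lambda>\<theta>. graph_coeff k \<theta> (z + s *\<^sub>R (v, 0)))"
      using k by (rule null_projection_graph_coeff)
    then show ?thesis
      using c history_subset by (subst (asm) null_projection_cong) auto
  qed
  then have "null_projection (\<lambda>\<theta>. c \<theta> 1)"
    using k by (intro subspace_contains_linear_coefficient[of null_projection c k, OF null_projection_comb]) simp_all
  moreover have "xderiv (graph_coeff k \<theta>) z v = c \<theta> 1" if "\<theta> \<in> {-1..0}" for \<theta>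
    using that history_subset k
    by (intro xderiv_eq_linear_coefficient[where n = k] c graph_coeff_differentiable[OF k1]) auto
  ultimately show ?thesis
    by (subst null_projection_cong)
qed

lemma xderiv_graph_coeff_1:
  assumes "\<theta> \<in> {-\<tau>..0}"
  shows "xderiv (graph_coeff 1 \<theta>) z v = basis_row \<theta> \<bullet> v"
proof -
  define c where "c i = (if i = 0 then basis_row \<theta> \<bullet> fst z else basis_row \<theta> \<bullet> v)" for i :: nat
  have "xderiv (graph_coeff 1 \<theta>) z v = c 1"
    using two_le_m assms
    by (intro xderiv_eq_linear_coefficient[where n = 1] graph_coeff_differentiable)
      (auto simp: graph_coeff_def graph_form_def c_def inner_add_right mult.commute)
  then show ?thesis by (simp add: c_def)
qed

text \<open>The core of the reduction. In \<open>invariance_coefficients\<close> the graph order \<open>k = 1\<close> contributes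
  \<open>B(\<theta>) A\<^sup>j\<close>, and every term with \<open>k \<ge> 2\<close> lies in the kernel of \<open>B\<^sup>\<dagger>\<close>; hence
  \<open>basis_coordinates_of_derivative\<close> applies to \<open>u = h\<^sup>j\<close>.\<close>

lemma field_coeff_direction:
  assumes j: "j \<in> {2..m}"
  shows "field_coeff j z =
    (graph_slope j 0 z - graph_coeff j 0 z + graph_coeff j (-1) z) *\<^sub>R vector [2/3, 2]"
proof (rule basis_coordinates_of_derivative)
  have j1: "j \<in> {1..m}" using j by auto
  show "((\<lambda>\<theta>. graph_coeff j \<theta> z) has_real_derivative graph_slope j \<theta> z) (at \<theta> within {-1..0})"
    if "\<theta> \<in> {-1..0}" for \<theta>
    using graph_coeff_has_slope[OF j1, of \<theta> z] that history_subset
    by (auto simp: has_real_derivative_iff_has_vector_derivative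
        intro: has_vector_derivative_within_subset)
  let ?g = "\<lambda>\<theta>. \<Sum>k=2..m. \<Sum>l=1..m.
     if k - 1 + l = j then xderiv (graph_coeff k \<theta>) z (field_coeff l z) else 0"
  show "null_projection ?g"
  proof (intro null_projection_sum)
    fix k l assume "k \<in> {2..m}"
    then show "null_projection (\<lambda>\<theta>. if k - 1 + l = j
        then xderiv (graph_coeff k \<theta>) z (field_coeff l z) else 0)"
      by (cases "k - 1 + l = j") (simp_all add: null_projection_xderiv null_projection_zero)
  qed
  show "graph_slope j \<theta> z = basis_row \<theta> \<bullet> field_coeff j z + ?g \<theta>" if "\<theta> \<in> {-1..0}" for \<theta>
  proof -
    have \<theta>: "\<theta> \<in> {-\<tau>..0}" using that history_subset by auto
    let ?s = "\<lambda>k. \<Sum>l=1..m. if k - 1 + l = j then xderiv (graph_coeff k \<theta>) z (field_coeff l z) else 0"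
    have "graph_slope j \<theta> z = (\<Sum>k=1..m. ?s k)"
      by (rule invariance_coefficients[OF j1 \<theta>])
    also have "\<dots> = ?s 1 + (\<Sum>k=2..m. ?s k)"
      using two_le_m by (subst sum.atLeast_Suc_atMost) (auto simp: numeral_2_eq_2)
    also have "?s 1 = basis_row \<theta> \<bullet> field_coeff j z"
      using j1 by (simp add: xderiv_graph_coeff_1[OF \<theta>, simplified])
    finally show ?thesis .
  qed
  show "null_projection (\<lambda>\<theta>. graph_coeff j \<theta> z)"
    using j by (rule null_projection_graph_coeff)
qed

text \<open>The second invariance equation at order 2. With
  \<open>\<alpha> = 1 + p/3 + q/2\<close> and \<open>\<beta> = -1 + p/6 - q/2\<close>, the first two terms come from the
  parameters acting on the linear graph at \<open>0\<close> and \<open>-1\<close>. The last one is \<open>-1\<close> times the slope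
  \<open>x\<^sub>2\<close> of the linear graph times the shift \<open>-(x\<^sub>1 - b x\<^sub>2)\<close> of its argument.\<close>

lemma quadratic_defect:
  "graph_slope 2 0 (x, p, q) - graph_coeff 2 0 (x, p, q) + graph_coeff 2 (-1) (x, p, q)
    = (p / 3 + q / 2) * x $ 1 + (p / 6 - q / 2) * (x $ 1 - x $ 2) + x $ 2 * (x $ 1 - b * x $ 2)"
proof -
  let ?z = "(x, p, q)"
  (* At the state t z the graph is t (x1 + eta x2) + t^2 E t eta, its slope at 0 is t x2 + t^2 S t,
     the delay shift h(-b) is t delta, and the residual of the delay equation is t^2 G t: the terms
     of order 1 cancel because the linear graph solves the linearized equation. *)
  define E where "E t \<theta> = (\<Sum>j=2..m. t ^ (j - 2) * graph_coeff j \<theta> ?z)" for t \<theta>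
  define S where "S t = (\<Sum>j=2..m. t ^ (j - 2) * graph_slope j 0 ?z)" for t
  define \<delta> where "\<delta> t = x $ 1 - b * x $ 2 + t * E t (-b)" for t
  define \<theta> where "\<theta> t = -1 - t * \<delta> t" for t
  define a c where "a = p / 3 + q / 2" and "c = p / 6 - q / 2"
  define G where "G t = S t - E t 0 - a * (x $ 1 + t * E t 0) - x $ 2 * \<delta> t + E t (\<theta> t)
    - c * (x $ 1 - x $ 2 - t * (x $ 2 * \<delta> t) + t * E t (\<theta> t))" for t
  let ?R = "\<lambda>(x, p, q). vector_derivative (cm_graph m h (x, p, q)) (at 0 within {-\<tau>..0}) -
        dde_rhs b p q (cm_graph m h (x, p, q))"
  have pow: "t ^ j = t\<^sup>2 * t ^ (j - 2)" if "j \<in> {2..m}" for j and t :: real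
    using that by (metis atLeastAtMost_iff le_add_diff_inverse power_add)
  have split_first: "(\<Sum>j=1..m. f j) = f 1 + (\<Sum>j=2..m. f j)" for f :: "nat \<Rightarrow> real"
    using two_le_m by (subst sum.atLeast_Suc_atMost) (auto simp: numeral_2_eq_2)
  have graph: "cm_graph m h (t *\<^sub>R ?z) \<eta> = t * (x $ 1 + \<eta> * x $ 2) + t\<^sup>2 * E t \<eta>"
    if "\<eta> \<in> {-\<tau>..0}" for t \<eta>
  proof -
    have "cm_graph m h (t *\<^sub>R ?z) \<eta> = (\<Sum>j=1..m. t ^ j * graph_coeff j \<eta> ?z)"
      unfolding cm_graph_eq using that by (intro sum.cong refl graph_coeff_homogeneous)
    also have "\<dots> = t * graph_coeff 1 \<eta> ?z + (\<Sum>j=2..m. t ^ j * graph_coeff j \<eta> ?z)"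
      unfolding split_first by simp
    also have "(\<Sum>j=2..m. t ^ j * graph_coeff j \<eta> ?z) = t\<^sup>2 * E t \<eta>"
      unfolding E_def sum_distrib_left by (intro sum.cong refl) (subst pow, auto)
    finally show ?thesis by (simp add: graph_coeff_def graph_form_def inner_basis_row)
  qed
  have zero_mem: "0 \<in> {-\<tau>..0}" and b_mem: "-b \<in> {-\<tau>..0}" and one_mem: "-1 \<in> {-\<tau>..0}"
    using one_less_tau b_less_tau b_ge_0 by auto
  have slope: "vector_derivative (cm_graph m h (t *\<^sub>R ?z)) (at 0 within {-\<tau>..0}) = t * x $ 2 + t\<^sup>2 * S t" for t
  proof -
    have "vector_derivative (cm_graph m h (t *\<^sub>R ?z)) (at 0 within {-\<tau>..0})
        = (\<Sum>j=1..m. t ^ j * graph_slope j 0 ?z)"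
      unfolding cm_graph_slope[OF zero_mem]
      by (intro sum.cong refl graph_slope_homogeneous zero_mem)
    also have "\<dots> = t * graph_slope 1 0 ?z + (\<Sum>j=2..m. t ^ j * graph_slope j 0 ?z)"
      unfolding split_first by simp
    also have "(\<Sum>j=2..m. t ^ j * graph_slope j 0 ?z) = t\<^sup>2 * S t"
      unfolding S_def sum_distrib_left by (intro sum.cong refl) (subst pow, auto)
    finally show ?thesis using graph_slope_1[OF zero_mem] by simp
  qed
  (* Only the order 2 term of E survives. Continuity in theta is needed because the delayed
     argument moves with t. *)
  have E_lim: "((\<lambda>t. E t (\<eta> t)) \<longlongrightarrow> graph_coeff 2 \<eta>\<^sub>0 ?z) (at 0)"
    if lim: "(\<eta> \<longlongrightarrow> \<eta>\<^sub>0) (at 0)" and mem: "\<eta>\<^sub>0 \<in> {-\<tau>..0}" "eventually (\<lambda>t. \<eta> t \<in> {-\<tau>..0}) (at 0)"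
    for \<eta> \<eta>\<^sub>0
  proof -
    have "((\<lambda>t. E t (\<eta> t)) \<longlongrightarrow> (\<Sum>j=2..m. 0 ^ (j - 2) * graph_coeff j \<eta>\<^sub>0 ?z)) (at 0)"
      unfolding E_def
      by (intro tendsto_intros continuous_on_tendsto_compose[OF graph_coeff_continuous lim mem]) auto
    also have "(\<Sum>j=2..m. 0 ^ (j - 2) * graph_coeff j \<eta>\<^sub>0 ?z) = (\<Sum>j=2..m. if j = 2 then graph_coeff j \<eta>\<^sub>0 ?z else 0)"
      by (intro sum.cong) (auto simp: power_0_left)
    finally show ?thesis using two_le_m by simp
  qed
  have S_lim: "(S \<longlongrightarrow> graph_slope 2 0 ?z) (at 0)"
  proof -
    have "((\<lambda>t. S t) \<longlongrightarrow> (\<Sum>j=2..m. 0 ^ (j - 2) * graph_slope j 0 ?z)) (at 0)"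
      unfolding S_def by (intro tendsto_intros)
    also have "(\<Sum>j=2..m. 0 ^ (j - 2) * graph_slope j 0 ?z) = (\<Sum>j=2..m. if j = 2 then graph_slope j 0 ?z else 0)"
      by (intro sum.cong) (auto simp: power_0_left)
    finally show ?thesis using two_le_m by simp
  qed
  have E0_lim: "((\<lambda>t. E t 0) \<longlongrightarrow> graph_coeff 2 0 ?z) (at 0)"
    and Eb_lim: "((\<lambda>t. E t (-b)) \<longlongrightarrow> graph_coeff 2 (-b) ?z) (at 0)"
    using zero_mem b_mem by (intro E_lim; simp)+
  have \<delta>_lim: "(\<delta> \<longlongrightarrow> x $ 1 - b * x $ 2) (at 0)"
    unfolding \<delta>_def[abs_def] by (auto intro!: tendsto_eq_intros Eb_lim)
  have \<theta>_lim: "(\<theta> \<longlongrightarrow> -1) (at 0)"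
    unfolding \<theta>_def[abs_def] by (auto intro!: tendsto_eq_intros \<delta>_lim)
  have \<theta>_mem: "eventually (\<lambda>t. \<theta> t \<in> {-\<tau>..0}) (at 0)"
  proof -
    have "eventually (\<lambda>t. -\<tau> < \<theta> t) (at 0)" "eventually (\<lambda>t. \<theta> t < 0) (at 0)"
      using one_less_tau order_tendstoD[OF \<theta>_lim] by auto
    then show ?thesis by eventually_elim auto
  qed
  have E\<theta>_lim: "((\<lambda>t. E t (\<theta> t)) \<longlongrightarrow> graph_coeff 2 (-1) ?z) (at 0)"
    by (rule E_lim[OF \<theta>_lim one_mem \<theta>_mem])
  have "(G \<longlongrightarrow> graph_slope 2 0 ?z - graph_coeff 2 0 ?z - a * x $ 1 - x $ 2 * (x $ 1 - b * x $ 2)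
      + graph_coeff 2 (-1) ?z - c * (x $ 1 - x $ 2)) (at 0)"
    unfolding G_def[abs_def]
    by (auto intro!: tendsto_eq_intros S_lim E0_lim \<delta>_lim E\<theta>_lim)
  moreover have "(G \<longlongrightarrow> 0) (at 0)"
  proof -
    have residual: "?R (t *\<^sub>R ?z) = t\<^sup>2 * G t" if \<theta>t: "\<theta> t \<in> {-\<tau>..0}" for t
    proof -
      have "cm_graph m h (t *\<^sub>R ?z) (-b) = t * \<delta> t"
        unfolding graph[OF b_mem] \<delta>_def by (simp add: algebra_simps power2_eq_square)
      then have "cm_graph m h (t *\<^sub>R ?z) (-1 - cm_graph m h (t *\<^sub>R ?z) (-b)) = cm_graph m h (t *\<^sub>R ?z) (\<theta> t)"
        by (simp add: \<theta>_def)
      moreover have "alpha_beta (t * p) (t * q) $ 1 = 1 + t * a" "alpha_beta (t * p) (t * q) $ 2 = -1 + t * c"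
        by (simp_all add: alpha_beta_def a_def c_def matrix_vector_mult_def sum_2 algebra_simps)
      ultimately have "dde_rhs b (t * p) (t * q) (cm_graph m h (t *\<^sub>R ?z)) =
         (1 + t * a) * (t * (x $ 1 + 0 * x $ 2) + t\<^sup>2 * E t 0)
         + (-1 + t * c) * (t * (x $ 1 + \<theta> t * x $ 2) + t\<^sup>2 * E t (\<theta> t))"
        unfolding dde_rhs_def by (simp only: graph[OF zero_mem] graph[OF \<theta>t])
      also have "\<dots> = t * x $ 2 + t\<^sup>2 * S t - t\<^sup>2 * G t"
        unfolding G_def by (subst \<theta>_def) (simp add: algebra_simps power2_eq_square)
      finally show ?thesis using slope[of t] by simp
    qed
    have "(\<lambda>t. ?R (t *\<^sub>R ?z)) \<in> O[at 0](\<lambda>t. t ^ (m + 1))"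
      by (rule vanishes_to_order_along_ray[OF delay_equation_residual])
    moreover have "((\<lambda>t::real. t ^ (m + 1) / t\<^sup>2) \<longlongrightarrow> 0) (at 0)"
    proof (rule Lim_transform_eventually)
      show "((\<lambda>t::real. t ^ (m - 1)) \<longlongrightarrow> 0) (at 0)"
        using two_le_m by (auto intro!: tendsto_eq_intros simp: power_0_left)
      have "t ^ (m - 1) = t ^ (m + 1) / t\<^sup>2" if "t \<noteq> 0" for t :: real
      proof -
        have "m + 1 = (m - 1) + 2" using two_le_m by simp
        then have "t ^ (m + 1) = t ^ (m - 1) * t\<^sup>2" by (metis power_add)
        then show ?thesis using that by simp
      qed
      then show "\<forall>\<^sub>F t::real in at 0. t ^ (m - 1) = t ^ (m + 1) / t\<^sup>2"
        by (simp add: eventually_at_filter)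
    qed
    then have "(\<lambda>t::real. t ^ (m + 1)) \<in> o[at 0](\<lambda>t. t\<^sup>2)"
      by (intro smalloI_tendsto) (auto simp: eventually_at_filter)
    ultimately have "(\<lambda>t. ?R (t *\<^sub>R ?z)) \<in> o[at 0](\<lambda>t. t\<^sup>2)"
      by (rule landau_o.big_small_trans)
    then have "((\<lambda>t. ?R (t *\<^sub>R ?z) / t\<^sup>2) \<longlongrightarrow> 0) (at 0)"
      by (rule smalloD_tendsto)
    moreover have "eventually (\<lambda>t. ?R (t *\<^sub>R ?z) / t\<^sup>2 = G t) (at 0)"
      using \<theta>_mem eventually_neq_at_within[of 0 0 UNIV]
    proof eventually_elim
      case (elim t)
      then show ?case by (simp only: residual) simp
    qed
    ultimately show ?thesis by (rule Lim_transform_eventually)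
  qed
  ultimately have "graph_slope 2 0 ?z - graph_coeff 2 0 ?z - a * x $ 1 - x $ 2 * (x $ 1 - b * x $ 2)
      + graph_coeff 2 (-1) ?z - c * (x $ 1 - x $ 2) = 0"
    using LIM_unique by blast
  then show ?thesis unfolding a_def c_def by linarith
qed

section \<open>The second-order equation\<close>

text \<open>The nonlinear terms are multiples of \<open>(2/3, 2)\<close>, so the first component is a third of the
  second apart from the linear term \<open>x\<^sub>2\<close>.\<close>

lemma cm_field_nth:
  "cm_field m A z $ 1 = fst z $ 2 + cm_field m A z $ 2 / 3"
  "cm_field m A z $ 2 = (\<Sum>j=2..m. field_coeff j z $ 2)"
proof -
  have eq: "cm_field m A z = J0 *v fst z + (\<Sum>j=2..m. field_coeff j z)"
    by (simp add: cm_field_def field_coeff_def)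
  have J0: "(J0 *v x) $ 1 = x $ 2" "(J0 *v x) $ 2 = 0" for x
    by (simp_all add: J0_def matrix_vector_mult_def sum_2)
  show 2: "cm_field m A z $ 2 = (\<Sum>j=2..m. field_coeff j z $ 2)"
    by (simp add: eq J0)
  have "field_coeff j z $ 1 = field_coeff j z $ 2 / 3" if "j \<in> {2..m}" for j
    using field_coeff_direction[OF that, of z] by simp
  then have "(\<Sum>j=2..m. field_coeff j z $ 1) = (\<Sum>j=2..m. field_coeff j z $ 2) / 3"
    unfolding sum_divide_distrib by (rule sum.cong[OF refl])
  then show "cm_field m A z $ 1 = fst z $ 2 + cm_field m A z $ 2 / 3"
    unfolding 2 by (simp add: eq J0)
qed

lemma field_coeff_2:
  "field_coeff 2 (x, p, q) $ 2 =
     p * x $ 1 + (q - p / 3) * x $ 2 + 2 * x $ 1 * x $ 2 - 2 * b * (x $ 2)\<^sup>2"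
proof -
  have "field_coeff 2 (x, p, q) $ 2 =
      2 * (graph_slope 2 0 (x, p, q) - graph_coeff 2 0 (x, p, q) + graph_coeff 2 (-1) (x, p, q))"
    using two_le_m by (subst field_coeff_direction) auto
  then show ?thesis
    unfolding quadratic_defect by (simp add: algebra_simps power2_eq_square)
qed

definition cubic_remainder :: "state \<Rightarrow> real" where
  "cubic_remainder z = (\<Sum>j=3..m. field_coeff j (T_mat *v fst z, snd z) $ 2)"

lemma cubic_remainder_order: "vanishes_to_order 3 cubic_remainder"
proof -
  have "(\<lambda>z. field_coeff j (T_mat *v fst z, snd z) $ 2) \<in> O[nhds 0](\<lambda>z. norm z ^ 3)"
    if j: "j \<in> {3..m}" for j
  proof (rule homogeneous_bigo)
    have "real_polynomial_function (\<lambda>z. field_coeff j z $ 2)"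
      using multilinear_form_real_polynomial[OF A_component_multilinear[of j 2]] j
      by (simp add: field_coeff_def)
    then have "continuous_on UNIV (\<lambda>z. field_coeff j z $ 2)"
      by (simp add: differentiable_imp_continuous_on differentiable_on_real_polynomial_function)
    moreover have "continuous_on UNIV (\<lambda>z::state. (T_mat *v fst z, snd z))"
      by (intro continuous_intros bounded_linear.continuous_on[OF matrix_vector_mul_bounded_linear])
    ultimately show "continuous_on UNIV (\<lambda>z. field_coeff j (T_mat *v fst z, snd z) $ 2)"
      by (rule continuous_on_compose2) auto
    have scale: "(T_mat *v fst (t *\<^sub>R z), snd (t *\<^sub>R z)) = t *\<^sub>R (T_mat *v fst z, snd z)" for t and z :: state
      by (simp add: matrix_vector_mult_scaleR)
    have "j \<in> {1..m}" using j by simp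
    then show "field_coeff j (T_mat *v fst (t *\<^sub>R z), snd (t *\<^sub>R z)) $ 2
        = t ^ j * field_coeff j (T_mat *v fst z, snd z) $ 2" for t and z :: state
      unfolding scale by (simp only: field_coeff_homogeneous) simp
    show "3 \<le> j" using j by simp
  qed
  then show ?thesis
    unfolding vanishes_to_order_def cubic_remainder_def[abs_def] by (rule big_sum_in_bigo)
qed

text \<open>Substituting \<open>x\<^sub>1 = y\<^sub>1 + y\<^sub>2/3\<close> in \<open>field_coeff_2\<close> cancels \<open>- p x\<^sub>2/3\<close>, and \<open>2 x\<^sub>1 x\<^sub>2\<close>
  yields the term \<open>2/3\<close> in the coefficient of \<open>y\<^sub>2\<^sup>2\<close>.\<close>

lemma cm_field_y_eq:
  "cm_field_y m A (y, p, q) =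
     vector [y $ 2, p * y $ 1 + q * y $ 2 + 2 * y $ 1 * y $ 2 + (2/3 - 2 * b) * (y $ 2)\<^sup>2
       + cubic_remainder (y, p, q)]"
proof -
  let ?z = "(T_mat *v y, p, q)"
  have "cm_field m A ?z $ 2 = field_coeff 2 ?z $ 2 + cubic_remainder (y, p, q)"
    using two_le_m unfolding cm_field_nth(2) cubic_remainder_def
    by (subst sum.atLeast_Suc_atMost) (auto simp: numeral_3_eq_3 numeral_2_eq_2)
  also have "field_coeff 2 ?z $ 2 = p * y $ 1 + q * y $ 2 + 2 * y $ 1 * y $ 2 + (2/3 - 2 * b) * (y $ 2)\<^sup>2"
    unfolding field_coeff_2 T_mat_nth by (simp add: algebra_simps power2_eq_square)
  finally show ?thesis
    by (simp add: cm_field_y_def vec_eq_iff forall_2 T_mat_inverse_nth cm_field_nth(1) T_mat_nth)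
qed

end

theorem lemma1:
  fixes b \<tau> :: real and m :: nat
    and h :: "nat \<Rightarrow> real \<Rightarrow> (nat \<Rightarrow> state) \<Rightarrow> real"
    and A :: "nat \<Rightarrow> (nat \<Rightarrow> state) \<Rightarrow> real ^ 2"
  assumes "b \<ge> 0" and "\<tau> > 1" and "\<tau> > b" and "m \<ge> 2"
    and "cm_expansion \<tau> b m h A"
  shows "zorder (char_fun (linearization (dde_rhs b 0 0))) 0 = 2 \<and>
    (\<exists>R :: state \<Rightarrow> real. vanishes_to_order 3 R \<and>
      (\<forall>y p q. cm_field_y m A (y, p, q) =
         vector [y $ 2,
           p * y $ 1 + q * y $ 2 + 2 * y $ 1 * y $ 2 + (2/3 - 2 * b) * (y $ 2)\<^sup>2 + R (y, p, q)]) \<and>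
      (\<forall>(x\<^sub>c :: real \<Rightarrow> real ^ 2) (y\<^sub>c :: real \<Rightarrow> real ^ 2) y p q S.
         open S \<longrightarrow>
         (\<forall>t\<in>S. (x\<^sub>c has_vector_derivative cm_field m A (x\<^sub>c t, p, q)) (at t)) \<longrightarrow>
         (\<forall>t\<in>S. x\<^sub>c t = T_mat *v y\<^sub>c t) \<longrightarrow>
         (\<forall>t\<in>S. y t = y\<^sub>c t $ 1) \<longrightarrow>
         (\<forall>t\<in>S. (y has_real_derivative y\<^sub>c t $ 2) (at t) \<and>
           (deriv y has_real_derivative
             p * y t + q * deriv y t + 2 * y t * deriv y t + (2/3 - 2 * b) * (deriv y t)\<^sup>2
             + R (vector [y t, deriv y t], p, q)) (at t))))"
proof -
  interpret center_manifold_expansion \<tau> b m h A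
    using assms by unfold_locales
  let ?R = cubic_remainder
  let ?rhs = "\<lambda>u v p q. p * u + q * v + 2 * u * v + (2/3 - 2 * b) * v\<^sup>2 + ?R (vector [u, v], p, q)"
  have solution: "(y has_real_derivative y\<^sub>c t $ 2) (at t) \<and>
      (deriv y has_real_derivative ?rhs (y t) (deriv y t) p q) (at t)"
    if "open S" and t: "t \<in> S"
      and ode: "\<forall>t\<in>S. (x\<^sub>c has_vector_derivative cm_field m A (x\<^sub>c t, p, q)) (at t)"
      and xy: "\<forall>t\<in>S. x\<^sub>c t = T_mat *v y\<^sub>c t" and y: "\<forall>t\<in>S. y t = y\<^sub>c t $ 1"
    for x\<^sub>c y\<^sub>c :: "real \<Rightarrow> real ^ 2" and y p q S t
  proof -
    have y_eq: "y t = x\<^sub>c t $ 1 - x\<^sub>c t $ 2 / 3" and y2: "y\<^sub>c t $ 2 = x\<^sub>c t $ 2" if "t \<in> S" for t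
      using xy y that by (simp_all add: T_mat_nth)
    have nth: "((\<lambda>t. x\<^sub>c t $ k) has_real_derivative cm_field m A (x\<^sub>c t, p, q) $ k) (at t)" if "t \<in> S" for t k
      unfolding has_real_derivative_iff_has_vector_derivative
      by (rule bounded_linear.has_vector_derivative[OF bounded_linear_vec_nth bspec[OF ode that]])
    have dy: "(y has_real_derivative y\<^sub>c t $ 2) (at t)" if t: "t \<in> S" for t
    proof (rule has_field_derivative_transform_within_open[OF _ \<open>open S\<close> t])
      have "((\<lambda>t. x\<^sub>c t $ 1 - x\<^sub>c t $ 2 / 3) has_real_derivative
          cm_field m A (x\<^sub>c t, p, q) $ 1 - cm_field m A (x\<^sub>c t, p, q) $ 2 / 3) (at t)"
        by (intro DERIV_diff DERIV_cdivide nth t)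
      then show "((\<lambda>t. x\<^sub>c t $ 1 - x\<^sub>c t $ 2 / 3) has_real_derivative y\<^sub>c t $ 2) (at t)"
        by (simp add: cm_field_nth(1) y2[OF t])
    qed (simp add: y_eq)
    then have deriv_y: "deriv y t = y\<^sub>c t $ 2" if "t \<in> S" for t
      using that by (simp add: DERIV_imp_deriv)
    have "vector [y t, deriv y t] = y\<^sub>c t"
      using t y by (simp add: vec_eq_iff forall_2 deriv_y)
    then have "?rhs (y t) (deriv y t) p q = cm_field_y m A (y\<^sub>c t, p, q) $ 2"
      using t y by (simp add: cm_field_y_eq deriv_y)
    also have "\<dots> = cm_field m A (x\<^sub>c t, p, q) $ 2"
      using t xy by (simp add: cm_field_y_def T_mat_inverse_nth)
    finally have rhs: "?rhs (y t) (deriv y t) p q = cm_field m A (x\<^sub>c t, p, q) $ 2" .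
    have "(deriv y has_real_derivative cm_field m A (x\<^sub>c t, p, q) $ 2) (at t)"
      by (rule has_field_derivative_transform_within_open[OF nth[OF t] \<open>open S\<close> t])
        (simp add: deriv_y y2)
    then show ?thesis using dy[OF t] unfolding rhs by simp
  qed
  show ?thesis
    by (intro conjI exI[of _ ?R] allI impI ballI zorder_char_fun cubic_remainder_order cm_field_y_eq)
      (rule solution[THEN conjunct1] solution[THEN conjunct2]; assumption)+
qed

end
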